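(* Let $X=\{X_t,\ t\ge 0\}$ be a real-valued process with $X_0=0$, independent increments, continuous in probability, with càdlàg paths, such that $\mathbb{E}[X_t]=0$ and $\mathbb{E}[|X_t|^k]<\infty$ for all $t\ge 0$ and all $k\ge 1$. For $t\ge 0$ let $\sigma_t^2$ be the variance of the Gaussian part of the infinitely divisible law of $X_t$ and $\nu_t$ its Lévy measure, and set $$F_2(t)=\sigma_t^2+\int_{\mathbb{R}\setminus\{0\}}x^2\,\nu_t(dx),\qquad F_n(t)=\int_{\mathbb{R}\setminus\{0\}}x^n\,\nu_t(dx),\ n\ge 3.$$ Then for every $n\ge 1$ the process $$M^{(n)}_t=\Gamma_n\big(X_t,-F_2(t),\dots,-F_n(t)\big),\qquad t\ge 0,$$ is a martingale with respect to the natural filtration of $X$.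
   Context: The Kendall polynomials $\Gamma_n(x_1,\dots,x_n)$, $n\ge 1$, are the polynomials expressing moments in terms of cumulants: they are defined by the formal power series identity $$\exp\Big\{\sum_{n=1}^\infty \kappa_n\frac{u^n}{n!}\Big\}=\sum_{n=0}^\infty \Gamma_n(\kappa_1,\dots,\kappa_n)\frac{u^n}{n!},$$ with $\Gamma_0=1$ (so e.g. $\Gamma_1(x_1)=x_1$, $\Gamma_2(x_1,x_2)=x_1^2+x_2$, $\Gamma_3(x_1,x_2,x_3)=x_1^3+3x_1x_2+x_3$). Under the hypotheses, $\int_{|x|>1}|x|\,\nu_t(dx)<\infty$ and $\int|x|^n\nu_t(dx)<\infty$ for all $n\ge2$, and $F_n(t)$ is the $n$-th cumulant of $X_t$ for $n\ge 2$. *)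

theory Defs
  imports "HOL-Probability.Probability" "HOL-Computational_Algebra.Formal_Power_Series"
begin

text \<open>Kendall polynomials: exp(sum_{n>=1} kappa_n u^n/n!) = sum_n Gamma_n(kappa) u^n/n!.
  Gamma_n only depends on kappa 1, ..., kappa n.\<close>
definition kendall :: "nat \<Rightarrow> (nat \<Rightarrow> real) \<Rightarrow> real" where
  "kendall n \<kappa> = fact n *
     fps_nth ((fps_exp (1::real)) oo (Abs_fps (\<lambda>k. if k = 0 then 0 else \<kappa> k / fact k))) n"

definition levy_khintchine :: "real measure \<Rightarrow> real \<Rightarrow> real measure \<Rightarrow> bool" where
  "levy_khintchine \<mu> \<sigma>2 \<nu> \<longleftrightarrow>
     \<sigma>2 \<ge> 0 \<and> sets \<nu> = sets borel \<and> emeasure \<nu> {0} = 0 \<and>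
     integrable \<nu> (\<lambda>x. min 1 (x\<^sup>2)) \<and>
     (\<exists>b::real. \<forall>u::real. char \<mu> u =
        exp (\<i> * complex_of_real (b * u) - complex_of_real (\<sigma>2 * u\<^sup>2 / 2)
             + (CLINT x|\<nu>. iexp (u * x) - 1 - \<i> * complex_of_real (u * x * indicator {-1..1} x))))"

definition natural_filtration :: "'a measure \<Rightarrow> (real \<Rightarrow> 'a \<Rightarrow> real) \<Rightarrow> real \<Rightarrow> 'a measure" where
  "natural_filtration M X t =
     sigma (space M) (\<Union>s\<in>{0..t}. {X s -` A \<inter> space M | A. A \<in> sets borel})"

definition martingale_wrt :: "'a measure \<Rightarrow> (real \<Rightarrow> 'a measure) \<Rightarrow> (real \<Rightarrow> 'a \<Rightarrow> real) \<Rightarrow> bool" where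
  "martingale_wrt M F Y \<longleftrightarrow>
     (\<forall>t\<ge>0. integrable M (Y t) \<and> Y t \<in> borel_measurable (F t)) \<and>
     (\<forall>s t A. 0 \<le> s \<longrightarrow> s \<le> t \<longrightarrow> A \<in> sets (F s) \<longrightarrow>
        (LINT \<omega>:A|M. Y t \<omega>) = (LINT \<omega>:A|M. Y s \<omega>))"

end

theory Submission
  imports Defs
begin

text \<open>Write \<open>m\<^sub>t(u) = \<Sum> E[X\<^sub>t^n] u^n / n!\<close> as a formal power series. Once \<open>m\<^sub>t\<close> is known to be the formal
  exponential of \<open>\<Sum> F\<^sub>k(t) u^k / k!\<close> (sum over \<open>k \<ge> 2\<close>), the variable \<open>M\<^sub>t\<close> is \<open>n!\<close> times the
  coefficient of \<open>u^n\<close> in \<open>exp(u X\<^sub>t) / m\<^sub>t(u)\<close>, an Appell polynomial in \<open>X\<^sub>t\<close>. For \<open>s < t\<close> the increment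
  \<open>D = X\<^sub>t - X\<^sub>s\<close> is independent of the past, so \<open>m\<^sub>t\<close> is \<open>m\<^sub>s\<close> times the moment series of \<open>D\<close>, and the
  latter cancels when \<open>exp(u X\<^sub>t) = exp(u X\<^sub>s) exp(u D)\<close> is integrated over an event of the past.

  That the \<open>F\<^sub>k\<close> are the cumulants follows by comparing asymptotic expansions at 0 of the two sides of
  the Levy-Khintchine formula. This requires the moments of the Levy measure to be finite: by the
  formula, \<open>\<integral> (cos(u x) - 1) d\<nu>\<close> equals the logarithm of the modulus of the characteristic function up
  to a quadratic term, so it has an asymptotic expansion to all orders, and its even-order central
  differences bound the even moments of \<open>\<nu>\<close>.\<close>

section \<open>Asymptotic expansions at 0\<close>

lemma fps_cutoff_has_fps_expansion:
  fixes A :: "'a::{real_normed_field,banach} fps"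
  shows "(\<lambda>z. \<Sum>j<N. fps_nth A j * z ^ j) has_fps_expansion fps_cutoff N A"
proof (rule has_fps_expansion_schematicI)
  show "(\<lambda>z. \<Sum>j<N. fps_nth A j * z ^ j)
      has_fps_expansion (\<Sum>j<N. fps_const (fps_nth A j) * fps_X ^ j)"
    by (intro fps_expansion_intros)
  show "(\<Sum>j<N. fps_const (fps_nth A j) * fps_X ^ j) = fps_cutoff N A"
    by (simp add: fps_eq_iff fps_sum_nth if_distrib cong: if_cong)
qed

lemma has_fps_expansion_imp_bigo_1:
  fixes g :: "'a::{real_normed_field,banach} \<Rightarrow> 'a"
  assumes "g has_fps_expansion G"
  shows "g \<in> O[nhds 0](\<lambda>_. 1)"
proof (rule bigoI_tendsto)
  have "isCont g 0"
    using has_fps_expansion_imp_continuous[OF assms, of UNIV] by simp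
  then show "((\<lambda>z. g z / 1) \<longlongrightarrow> g 0) (nhds 0)"
    by (simp add: isCont_def tendsto_at_iff_tendsto_nhds)
qed simp

lemma has_fps_expansion_remainder_bigo:
  fixes g :: "'a::{real_normed_field,banach} \<Rightarrow> 'a"
  assumes g: "g has_fps_expansion G"
  shows "(\<lambda>z. g z - (\<Sum>j<N. fps_nth G j * z ^ j)) \<in> O[nhds 0](\<lambda>z. z ^ N)"
proof -
  let ?q = "eval_fps (fps_shift N G)"
  have q: "?q has_fps_expansion fps_shift N G"
    using g by (intro eval_fps_has_fps_expansion) (simp add: has_fps_expansion_def)
  have "(\<lambda>z. ?q z * z ^ N + (\<Sum>j<N. fps_nth G j * z ^ j))
      has_fps_expansion fps_shift N G * fps_X ^ N + fps_cutoff N G"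
    by (intro fps_expansion_intros q fps_cutoff_has_fps_expansion)
  then have "(\<lambda>z. ?q z * z ^ N + (\<Sum>j<N. fps_nth G j * z ^ j)) has_fps_expansion G"
    by (simp add: fps_shift_cutoff)
  then have "\<forall>\<^sub>F z in nhds 0. eval_fps G z = ?q z * z ^ N + (\<Sum>j<N. fps_nth G j * z ^ j)"
    and "\<forall>\<^sub>F z in nhds 0. eval_fps G z = g z"
    using g by (auto simp: has_fps_expansion_def)
  then have "\<forall>\<^sub>F z in nhds 0. g z - (\<Sum>j<N. fps_nth G j * z ^ j) = ?q z * z ^ N"
    by eventually_elim simp
  moreover have "(\<lambda>z. ?q z * z ^ N) \<in> O[nhds 0](\<lambda>z. 1 * z ^ N)"
    by (intro landau_o.big.mult has_fps_expansion_imp_bigo_1[OF q] landau_o.big_refl)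
  ultimately show ?thesis
    by (simp add: landau_o.big.in_cong)
qed

lemma bigo_imp_tendsto_0:
  fixes f :: "'a \<Rightarrow> 'b::real_normed_field"
  assumes "f \<in> O[F](g)" and g: "(g \<longlongrightarrow> 0) F"
  shows "(f \<longlongrightarrow> 0) F"
proof -
  obtain C where "\<forall>\<^sub>F x in F. norm (f x) \<le> C * norm (g x)"
    using assms(1) by (rule landau_o.bigE)
  moreover have "((\<lambda>x. C * norm (g x)) \<longlongrightarrow> 0) F"
    using tendsto_mult_right_zero[OF tendsto_norm_zero[OF g]] .
  ultimately show ?thesis
    by (rule Lim_null_comparison)
qed

definition asym_expansion :: "(real \<Rightarrow> 'a::real_normed_field) \<Rightarrow> 'a fps \<Rightarrow> bool" where
  "asym_expansion f A \<longleftrightarrow>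
     (\<forall>N. (\<lambda>u. f u - (\<Sum>j<N. fps_nth A j * of_real u ^ j)) \<in> O[nhds 0](\<lambda>u. of_real u ^ N))"

lemma asym_expansionD:
  "asym_expansion f A \<Longrightarrow>
     (\<lambda>u. f u - (\<Sum>j<N. fps_nth A j * of_real u ^ j)) \<in> O[nhds 0](\<lambda>u. of_real u ^ N)"
  by (simp add: asym_expansion_def)

lemma asym_expansion_imp_bigo_1: "asym_expansion f A \<Longrightarrow> f \<in> O[nhds 0](\<lambda>_. 1)"
  using asym_expansionD[of f A 0] by simp

lemma has_fps_expansion_imp_asym_expansion:
  fixes g :: "'a::{real_normed_field,banach} \<Rightarrow> 'a"
  assumes "g has_fps_expansion G"
  shows "asym_expansion (\<lambda>u. g (of_real u)) G"
  unfolding asym_expansion_def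
proof
  fix N
  have "filterlim (of_real :: real \<Rightarrow> 'a) (nhds 0) (nhds 0)"
    by (rule tendsto_eq_intros filterlim_ident refl | simp)+
  then show "(\<lambda>u. g (of_real u) - (\<Sum>j<N. fps_nth G j * of_real u ^ j)) \<in> O[nhds 0](\<lambda>u. of_real u ^ N)"
    by (rule landau_o.big.compose[OF has_fps_expansion_remainder_bigo[OF assms]])
qed

lemma of_real_power_bigo_mono:
  assumes "N \<le> k"
  shows "(\<lambda>u::real. (of_real u :: 'a::real_normed_field) ^ k) \<in> O[nhds 0](\<lambda>u. of_real u ^ N)"
proof (rule bigoI[where c = 1])
  have "\<forall>\<^sub>F u in nhds 0. \<bar>u :: real\<bar> < 1"
    using eventually_nhds_metric[of "\<lambda>u::real. \<bar>u\<bar> < 1" 0] by (auto intro!: exI[of _ 1])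
  then show "\<forall>\<^sub>F u in nhds 0. norm ((of_real u :: 'a) ^ k) \<le> 1 * norm ((of_real u :: 'a) ^ N)"
    by eventually_elim (use assms in \<open>auto simp: norm_power intro!: power_decreasing\<close>)
qed

lemma asym_expansion_zero_imp_eq_0:
  fixes A :: "'a::real_normed_field fps"
  assumes "asym_expansion (\<lambda>_. 0) A"
  shows "A = 0"
proof (rule ccontr)
  assume "A \<noteq> 0"
  define n where "n = subdegree A"
  have sum_eq: "(\<Sum>j<Suc n. fps_nth A j * of_real u ^ j) = fps_nth A n * of_real u ^ n" for u :: real
    by (auto simp: n_def intro!: sum.neutral)
  have "(\<lambda>u. - (\<Sum>j<Suc n. fps_nth A j * of_real u ^ j)) \<in> O[nhds 0](\<lambda>u. of_real u ^ Suc n)"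
    using asym_expansionD[OF assms, of "Suc n"] by simp
  then have "(\<lambda>u. fps_nth A n * of_real u ^ n) \<in> O[nhds 0](\<lambda>u. (of_real u :: 'a) ^ Suc n)"
    unfolding sum_eq landau_o.big.uminus_in_iff .
  then have "(\<lambda>u. fps_nth A n * of_real u ^ n) \<in> O[at 0](\<lambda>u. of_real u * (of_real u :: 'a) ^ n)"
    unfolding power_Suc by (rule landau_o.big.filter_mono[OF at_within_le_nhds])
  then have "(\<lambda>_. fps_nth A n) \<in> O[at 0](\<lambda>u::real. of_real u :: 'a)"
    by (subst (asm) landau_o.big.mult_cancel_right) (auto simp: frequently_def eventually_at_filter)
  moreover have "((\<lambda>u::real. of_real u :: 'a) \<longlongrightarrow> 0) (at 0)"
    by (rule tendsto_eq_intros refl | simp)+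
  ultimately have "((\<lambda>_::real. fps_nth A n) \<longlongrightarrow> 0) (at 0)"
    by (rule bigo_imp_tendsto_0)
  then have "fps_nth A n = 0"
    by (simp add: tendsto_const_iff)
  then show False
    using \<open>A \<noteq> 0\<close> by (simp add: n_def)
qed

lemma asym_expansion_add:
  assumes "asym_expansion f A" "asym_expansion g B"
  shows "asym_expansion (\<lambda>u. f u + g u) (A + B)"
  unfolding asym_expansion_def
proof
  fix N
  have "(\<lambda>u. (f u - (\<Sum>j<N. fps_nth A j * of_real u ^ j)) + (g u - (\<Sum>j<N. fps_nth B j * of_real u ^ j)))
          \<in> O[nhds 0](\<lambda>u. of_real u ^ N)"
    by (intro sum_in_bigo asym_expansionD assms)
  then show "(\<lambda>u. f u + g u - (\<Sum>j<N. fps_nth (A + B) j * of_real u ^ j))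
          \<in> O[nhds 0](\<lambda>u. of_real u ^ N)"
    by (simp add: sum.distrib algebra_simps)
qed

lemma asym_expansion_const:
  "asym_expansion (\<lambda>_. c :: 'a::{real_normed_field,banach}) (fps_const c)"
  using has_fps_expansion_imp_asym_expansion[OF has_fps_expansion_const] .

lemma asym_expansion_sum:
  fixes f :: "'i \<Rightarrow> real \<Rightarrow> 'a::{real_normed_field,banach}"
  assumes "\<And>i. i \<in> I \<Longrightarrow> asym_expansion (f i) (A i)"
  shows "asym_expansion (\<lambda>u. \<Sum>i\<in>I. f i u) (\<Sum>i\<in>I. A i)"
  using assms
proof (induction I rule: infinite_finite_induct)
  case (insert i I)
  then show ?case by (simp add: asym_expansion_add)
qed (use asym_expansion_const[of 0] in simp_all)

lemma asym_expansion_mult: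
  fixes f g :: "real \<Rightarrow> 'a::{real_normed_field,banach}"
  assumes f: "asym_expansion f A" and g: "asym_expansion g B"
  shows "asym_expansion (\<lambda>u. f u * g u) (A * B)"
  unfolding asym_expansion_def
proof
  fix N
  let ?O = "O[nhds 0](\<lambda>u::real. (of_real u :: 'a) ^ N)"
  define P Q where "P z = (\<Sum>j<N. fps_nth A j * z ^ j)" and "Q z = (\<Sum>j<N. fps_nth B j * z ^ j)"
    for z :: 'a
  have P: "P has_fps_expansion fps_cutoff N A" and Q: "Q has_fps_expansion fps_cutoff N B"
    unfolding P_def Q_def by (rule fps_cutoff_has_fps_expansion)+
  have truncate_f: "(\<lambda>u. (f u - P (of_real u)) * g u) \<in> O[nhds 0](\<lambda>u. of_real u ^ N * 1)"
    unfolding P_def by (intro landau_o.big.mult asym_expansionD[OF f] asym_expansion_imp_bigo_1[OF g])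
  have truncate_g: "(\<lambda>u. P (of_real u) * (g u - Q (of_real u))) \<in> O[nhds 0](\<lambda>u. 1 * of_real u ^ N)"
    using asym_expansion_imp_bigo_1[OF has_fps_expansion_imp_asym_expansion[OF P]]
    unfolding Q_def by (intro landau_o.big.mult asym_expansionD g)
  have "(\<lambda>u. P (of_real u) * Q (of_real u) - (\<Sum>j<N. fps_nth (A * B) j * of_real u ^ j)) \<in> ?O"
    using asym_expansionD[OF has_fps_expansion_imp_asym_expansion[OF has_fps_expansion_mult[OF P Q]], of N]
    by (simp add: fps_cutoff_left_mult_nth fps_cutoff_right_mult_nth)
  with sum_in_bigo(1)[OF truncate_f[simplified] truncate_g[simplified]]
  have "(\<lambda>u. (f u - P (of_real u)) * g u + P (of_real u) * (g u - Q (of_real u))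
      + (P (of_real u) * Q (of_real u) - (\<Sum>j<N. fps_nth (A * B) j * of_real u ^ j))) \<in> ?O"
    by (rule sum_in_bigo)
  then show "(\<lambda>u. f u * g u - (\<Sum>j<N. fps_nth (A * B) j * of_real u ^ j)) \<in> ?O"
    by (simp add: algebra_simps)
qed

lemma asym_expansion_cmult:
  fixes f :: "real \<Rightarrow> 'a::{real_normed_field,banach}"
  assumes "asym_expansion f A"
  shows "asym_expansion (\<lambda>u. c * f u) (fps_const c * A)"
  using asym_expansion_mult[OF asym_expansion_const assms] .

lemma asym_expansion_power:
  fixes f :: "real \<Rightarrow> 'a::{real_normed_field,banach}"
  assumes "asym_expansion f A"
  shows "asym_expansion (\<lambda>u. f u ^ n) (A ^ n)"
proof (induction n)
  case 0
  then show ?case using asym_expansion_const[of 1] by simp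
next
  case (Suc n)
  then show ?case using asym_expansion_mult[OF assms] by simp
qed

lemma asym_expansion_unique:
  fixes f :: "real \<Rightarrow> 'a::{real_normed_field,banach}"
  assumes "asym_expansion f A" "asym_expansion f B"
  shows "A = B"
proof -
  have "asym_expansion (\<lambda>u. f u + (-1) * f u) (A + fps_const (-1) * B)"
    by (intro asym_expansion_add asym_expansion_cmult assms)
  then have "A + fps_const (-1) * B = 0"
    by (intro asym_expansion_zero_imp_eq_0) simp
  then show ?thesis
    by (simp flip: fps_const_neg)
qed

lemma asym_expansion_scale:
  fixes f :: "real \<Rightarrow> 'a::real_normed_field"
  assumes "asym_expansion f A"
  shows "asym_expansion (\<lambda>u. f (c * u)) (A oo (fps_const (of_real c) * fps_X))"
  unfolding asym_expansion_def
proof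
  fix N
  have "filterlim (\<lambda>u::real. c * u) (nhds 0) (nhds 0)"
    by (rule tendsto_eq_intros filterlim_ident refl | simp)+
  from landau_o.big.compose[OF asym_expansionD[OF assms, of N] this]
  have "(\<lambda>u. f (c * u) - (\<Sum>j<N. fps_nth A j * of_real (c * u) ^ j))
         \<in> O[nhds 0](\<lambda>u. of_real c ^ N * of_real u ^ N)"
    by (simp add: power_mult_distrib)
  also have "(\<lambda>u. of_real c ^ N * (of_real u :: 'a) ^ N) \<in> O[nhds 0](\<lambda>u::real. of_real u ^ N)"
    by simp
  finally show "(\<lambda>u. f (c * u) - (\<Sum>j<N. fps_nth (A oo (fps_const (of_real c) * fps_X)) j * of_real u ^ j))
       \<in> O[nhds 0](\<lambda>u. of_real u ^ N)"
    by (simp add: power_mult_distrib fps_compose_linear mult.assoc mult.left_commute)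
qed

lemma bounded_linear_bigo:
  assumes "bounded_linear L" and "f \<in> O[F](g)" and "\<And>x. norm (g x) = norm (h x)"
  shows "(\<lambda>x. L (f x)) \<in> O[F](h)"
proof -
  obtain K where K: "K \<ge> 0" "\<And>x. norm (L x) \<le> norm x * K"
    using bounded_linear.nonneg_bounded[OF assms(1)] by blast
  obtain C where "\<forall>\<^sub>F x in F. norm (f x) \<le> C * norm (g x)"
    using assms(2) by (rule landau_o.bigE)
  then have "\<forall>\<^sub>F x in F. norm (L (f x)) \<le> C * K * norm (h x)"
  proof eventually_elim
    case (elim x)
    have "norm (L (f x)) \<le> norm (f x) * K" by (rule K)
    also have "\<dots> \<le> C * norm (g x) * K" using elim K by (intro mult_right_mono)
    finally show ?case by (simp add: assms mult_ac)
  qed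
  then show ?thesis by (rule bigoI)
qed

lemma asym_expansion_bounded_linear:
  fixes f :: "real \<Rightarrow> 'a::real_normed_field" and L :: "'a \<Rightarrow> 'b::real_normed_field"
  assumes f: "asym_expansion f A" and L: "bounded_linear L"
  shows "asym_expansion (\<lambda>u. L (f u)) (Abs_fps (\<lambda>n. L (fps_nth A n)))"
  unfolding asym_expansion_def
proof
  fix N
  interpret bounded_linear L by (rule L)
  have "(\<lambda>u. L (f u - (\<Sum>j<N. fps_nth A j * of_real u ^ j))) \<in> O[nhds 0](\<lambda>u. of_real u ^ N)"
    by (rule bounded_linear_bigo[OF L asym_expansionD[OF f]]) (simp add: norm_power)
  moreover have "L (a * of_real u ^ j) = L a * of_real u ^ j" for a u j
    using scaleR[of "u ^ j" a] by (simp add: scaleR_conv_of_real mult.commute)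
  ultimately show "(\<lambda>u. L (f u) - (\<Sum>j<N. fps_nth (Abs_fps (\<lambda>n. L (fps_nth A n))) j * of_real u ^ j))
      \<in> O[nhds 0](\<lambda>u. of_real u ^ N)"
    by (simp add: diff sum)
qed

lemma asym_expansion_compose:
  fixes f :: "real \<Rightarrow> 'a::{real_normed_field,banach}"
  assumes f: "asym_expansion f A" and A_0: "fps_nth A 0 = 0" and g: "g has_fps_expansion G"
  shows "asym_expansion (\<lambda>u. g (f u)) (G oo A)"
  unfolding asym_expansion_def
proof
  fix N
  let ?O = "O[nhds 0](\<lambda>u::real. (of_real u :: 'a) ^ N)"
  have f_bigo: "f \<in> O[nhds 0](\<lambda>u. of_real u)"
    using asym_expansionD[OF f, of 1] A_0 by simp
  moreover have "((\<lambda>u::real. of_real u :: 'a) \<longlongrightarrow> 0) (nhds 0)"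
    by (rule tendsto_eq_intros filterlim_ident refl | simp)+
  ultimately have "(f \<longlongrightarrow> 0) (nhds 0)"
    by (rule bigo_imp_tendsto_0)
  then have "(\<lambda>u. g (f u) - (\<Sum>n<N. fps_nth G n * f u ^ n)) \<in> O[nhds 0](\<lambda>u. f u ^ N)"
    by (rule landau_o.big.compose[OF has_fps_expansion_remainder_bigo[OF g]])
  also have "(\<lambda>u. f u ^ N) \<in> ?O"
    using f_bigo by (rule landau_o.big_power)
  finally have truncate_g: "(\<lambda>u. g (f u) - (\<Sum>n<N. fps_nth G n * f u ^ n)) \<in> ?O" .
  define B where "B = (\<Sum>n<N. fps_const (fps_nth G n) * A ^ n)"
  have "asym_expansion (\<lambda>u. \<Sum>n<N. fps_nth G n * f u ^ n) B"
    unfolding B_def by (intro asym_expansion_sum asym_expansion_cmult asym_expansion_power f)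
  from sum_in_bigo(1)[OF truncate_g asym_expansionD[OF this]]
  have "(\<lambda>u. g (f u) - (\<Sum>j<N. fps_nth B j * of_real u ^ j)) \<in> ?O"
    by simp
  moreover have "fps_nth B j = fps_nth (G oo A) j" if "j < N" for j
  proof -
    have "fps_nth B j = (\<Sum>n<N. fps_nth G n * fps_nth (A ^ n) j)"
      by (simp add: B_def fps_sum_nth)
    also have "\<dots> = (\<Sum>n\<in>{0..j}. fps_nth G n * fps_nth (A ^ n) j)"
      using that startsby_zero_power_prefix[OF A_0] by (intro sum.mono_neutral_right) auto
    finally show ?thesis by (simp add: fps_compose_nth)
  qed
  ultimately show "(\<lambda>u. g (f u) - (\<Sum>j<N. fps_nth (G oo A) j * of_real u ^ j)) \<in> ?O"
    by simp
qed

lemma has_fps_expansion_ln_1_plus: "(\<lambda>z::real. ln (1 + z)) has_fps_expansion fps_ln 1"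
proof (rule has_fps_expansionI)
  have "\<forall>\<^sub>F z in nhds 0. \<bar>z :: real\<bar> < 1"
    using eventually_nhds_metric[of "\<lambda>z::real. \<bar>z\<bar> < 1" 0] by (auto intro!: exI[of _ 1])
  then show "\<forall>\<^sub>F z in nhds 0. (\<lambda>n. fps_nth (fps_ln 1) n * z ^ n) sums ln (1 + z :: real)"
  proof eventually_elim
    case (elim z)
    have "fps_nth (fps_ln 1) n * z ^ n = - ((- z) ^ n) / real n" for n
      by (cases n) (auto simp: fps_ln_nth power_minus[of z])
    then show ?case using ln_series'[OF elim] by simp
  qed
qed

lemma asym_expansion_ln:
  fixes f :: "real \<Rightarrow> real"
  assumes "asym_expansion f A" "fps_nth A 0 = 1"
  shows "asym_expansion (\<lambda>u. ln (f u)) (fps_ln 1 oo (A - 1))"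
proof -
  have "asym_expansion (\<lambda>u. f u + (-1)) (A + fps_const (-1))"
    by (intro asym_expansion_add asym_expansion_const assms)
  then have "asym_expansion (\<lambda>u. f u - 1) (A - 1)"
    by (simp flip: fps_const_neg)
  then have "asym_expansion (\<lambda>u. ln (1 + (f u - 1))) (fps_ln 1 oo (A - 1))"
    by (rule asym_expansion_compose[OF _ _ has_fps_expansion_ln_1_plus]) (simp add: assms)
  then show ?thesis by simp
qed

lemma asym_expansion_ln_cmod:
  assumes A: "asym_expansion f A" and A_0: "fps_nth A 0 = 1"
  obtains B where "asym_expansion (\<lambda>u. ln (cmod (f u))) B"
proof -
  define B where "B = Abs_fps (\<lambda>n. Re (fps_nth A n)) ^ 2 + Abs_fps (\<lambda>n. Im (fps_nth A n)) ^ 2"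
  have "asym_expansion (\<lambda>u. Re (f u) ^ 2 + Im (f u) ^ 2) B"
    unfolding B_def
    by (intro asym_expansion_add asym_expansion_power asym_expansion_bounded_linear[OF A]
        bounded_linear_Re bounded_linear_Im)
  moreover have "fps_nth B 0 = 1"
    by (simp add: B_def A_0 power2_eq_square)
  ultimately have "asym_expansion (\<lambda>u. ln (Re (f u) ^ 2 + Im (f u) ^ 2)) (fps_ln 1 oo (B - 1))"
    by (rule asym_expansion_ln)
  then have "asym_expansion (\<lambda>u. 1 / 2 * ln (cmod (f u) ^ 2)) (fps_const (1 / 2) * (fps_ln 1 oo (B - 1)))"
    unfolding cmod_power2 by (rule asym_expansion_cmult)
  moreover have "1 / 2 * ln (r ^ 2) = ln r" if "r \<ge> 0" for r :: real
    using that by (cases "r = 0") (simp_all add: ln_realpow)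
  ultimately show thesis
    using that by simp
qed

section \<open>Finiteness of even moments\<close>

lemma alternating_binomial_power_sum_eq_0:
  fixes c :: "'a::field_char_0"
  assumes "i < n"
  shows "(\<Sum>j\<le>n. (-1) ^ j * of_nat (n choose j) * (of_nat j - c) ^ i) = 0"
proof -
  let ?E = "fps_exp :: 'a \<Rightarrow> 'a fps"
  have exp_nat: "(- ?E 1) ^ j = (-1) ^ j * ?E (of_nat j)" for j
    by (simp add: power_minus[of "?E 1"] fps_exp_power_mult)
  have exp_diff: "?E (of_nat j - c) = ?E (of_nat j) * ?E (- c)" for j
    by (simp flip: fps_exp_add_mult)
  have const: "fps_const ((-1) ^ j * of_nat m) = (-1) ^ j * (of_nat m :: 'a fps)" for j m
    by (simp add: fps_of_nat flip: fps_const_mult fps_const_power fps_const_neg)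
  have "(- ?E 1 + 1) ^ n * ?E (- c)
      = (\<Sum>j\<le>n. fps_const ((-1) ^ j * of_nat (n choose j)) * ?E (of_nat j - c))"
    unfolding binomial_ring sum_distrib_right exp_nat exp_diff const
    by (intro sum.cong) (simp_all add: mult_ac)
  then have "fps_nth ((- ?E 1 + 1) ^ n * ?E (- c)) i
      = (\<Sum>j\<le>n. (-1) ^ j * of_nat (n choose j) * (of_nat j - c) ^ i) / fact i"
    by (simp add: fps_sum_nth sum_divide_distrib)
  moreover have "fps_nth ((- ?E 1 + 1) ^ n * ?E (- c)) i = 0"
    using startsby_zero_power_prefix[of "- ?E 1 + 1" n] assms
    by (auto simp: fps_mult_nth intro!: sum.neutral)
  ultimately show ?thesis by simp
qed

lemma asym_expansion_finite_difference_bigo: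
  fixes f :: "real \<Rightarrow> 'a::{real_normed_field,banach}"
  assumes "asym_expansion f A"
  shows "(\<lambda>h. \<Sum>j\<le>n. (-1) ^ j * of_nat (n choose j) * f ((of_nat j - c) * h))
      \<in> O[nhds 0](\<lambda>h. of_real h ^ n)"
proof -
  define B where "B = (\<Sum>j\<le>n. fps_const ((-1) ^ j * of_nat (n choose j))
      * (A oo (fps_const (of_real (of_nat j - c)) * fps_X)))"
  have expansion: "asym_expansion (\<lambda>h. \<Sum>j\<le>n. (-1) ^ j * of_nat (n choose j) * f ((of_nat j - c) * h)) B"
    unfolding B_def
    by (intro asym_expansion_sum asym_expansion_cmult asym_expansion_scale assms)
  have "fps_nth B i = 0" if "i < n" for i
  proof -
    have "fps_nth B i = (\<Sum>j\<le>n. (-1) ^ j * of_nat (n choose j) * (of_nat j - of_real c) ^ i) * fps_nth A i"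
      unfolding B_def fps_sum_nth fps_mult_left_const_nth fps_nth_compose_linear
      by (simp add: sum_distrib_right mult.assoc)
    then show ?thesis
      by (simp only: alternating_binomial_power_sum_eq_0[OF that] mult_zero_left)
  qed
  then show ?thesis
    using asym_expansionD[OF expansion, of n] by simp
qed

lemma two_minus_two_cos_power:
  fixes y :: real
  shows "(2 - 2 * cos y) ^ k
     = (-1) ^ k * (\<Sum>j\<le>2*k. (-1) ^ j * of_nat (2*k choose j) * cos ((of_nat j - of_nat k) * y))"
proof -
  let ?S = "\<Sum>j\<le>2*k. (-1) ^ j * of_nat (2*k choose j) * cis ((of_nat j - of_nat k) * y)"
  have square: "(- cis y + 1) ^ 2 * cis (- y) = of_real (2 * cos y - 2)"
  proof -
    have "(- cis y + 1) ^ 2 * cis (- y)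
        = cis y * (cis y * cis (- y)) - 2 * (cis y * cis (- y)) + cis (- y)"
      by (simp add: power2_eq_square algebra_simps)
    also have "\<dots> = of_real (2 * cos y - 2)"
      by (simp add: cis_mult complex_eq_iff)
    finally show ?thesis .
  qed
  have "?S = (\<Sum>j\<le>2*k. of_nat (2*k choose j) * (- cis y) ^ j * 1 ^ (2 * k - j)) * cis (- (of_nat k * y))"
    unfolding sum_distrib_right
    by (intro sum.cong refl) (simp add: power_minus[of "cis y"] Complex.DeMoivre cis_mult algebra_simps)
  also have "\<dots> = (- cis y + 1) ^ (2 * k) * cis (- y) ^ k"
    unfolding binomial_ring[symmetric] by (simp add: Complex.DeMoivre)
  also have "\<dots> = of_real ((2 * cos y - 2) ^ k)"
    by (simp only: power_mult power_mult_distrib[symmetric] square of_real_power)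
  finally have "Re ?S = (2 * cos y - 2) ^ k"
    by (simp only: Re_complex_of_real)
  moreover have "Re ((-1) ^ j * of_nat m * z) = (-1) ^ j * of_nat m * Re z" for j m z
    by (cases "even j") simp_all
  ultimately have "(\<Sum>j\<le>2*k. (-1) ^ j * of_nat (2*k choose j) * cos ((of_nat j - of_nat k) * y))
      = (2 * cos y - 2) ^ k"
    by simp
  then show ?thesis
    by (simp flip: power_mult_distrib)
qed

lemma tendsto_two_minus_two_cos_power:
  "((\<lambda>h. ((2 - 2 * cos (h * x)) / h\<^sup>2) ^ k) \<longlongrightarrow> x ^ (2 * k)) (at 0)" for x :: real
proof -
  have "((\<lambda>h. 2 * sin (h * x / 2)) has_real_derivative x) (at 0)"
    by (auto intro!: derivative_eq_intros)
  then have "((\<lambda>h. 2 * sin (h * x / 2) / h) \<longlongrightarrow> x) (at 0)"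
    by (simp add: DERIV_def)
  then have "((\<lambda>h. (2 * sin (h * x / 2) / h) ^ (2 * k)) \<longlongrightarrow> x ^ (2 * k)) (at 0)"
    by (rule tendsto_power)
  moreover have "2 - 2 * cos (h * x) = (2 * sin (h * x / 2))\<^sup>2" for h
    using cos_double_sin[of "h * x / 2"] by (simp add: power_mult_distrib)
  ultimately show ?thesis
    by (simp add: power_divide power_mult)
qed

lemma
  fixes \<nu> :: "real measure"
  assumes int: "\<And>u. integrable \<nu> (\<lambda>x. cos (u * x) - 1)" and k: "k \<ge> 1"
  shows integrable_two_minus_two_cos_power: "integrable \<nu> (\<lambda>x. (2 - 2 * cos (h * x)) ^ k)"
    and lebesgue_integral_two_minus_two_cos_power:
      "(LINT x|\<nu>. (2 - 2 * cos (h * x)) ^ k)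
        = (-1) ^ k * (\<Sum>j\<le>2*k. (-1) ^ j * of_nat (2*k choose j)
            * (LINT x|\<nu>. cos ((of_nat j - of_nat k) * h * x) - 1))"
proof -
  have "(\<Sum>j\<le>2*k. (-1) ^ j * real (2*k choose j)) = 0"
    using k by (intro choose_alternating_sum) simp
  then have power_eq: "(2 - 2 * cos (h * x)) ^ k = (-1) ^ k * (\<Sum>j\<le>2*k. (-1) ^ j * of_nat (2*k choose j)
      * (cos ((of_nat j - of_nat k) * h * x) - 1))" for x
    unfolding two_minus_two_cos_power by (simp add: right_diff_distrib sum_subtractf mult.assoc)
  show "integrable \<nu> (\<lambda>x. (2 - 2 * cos (h * x)) ^ k)"
    unfolding power_eq by (intro integrable_mult_right Bochner_Integration.integrable_sum int)
  show "(LINT x|\<nu>. (2 - 2 * cos (h * x)) ^ k)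
      = (-1) ^ k * (\<Sum>j\<le>2*k. (-1) ^ j * of_nat (2*k choose j)
          * (LINT x|\<nu>. cos ((of_nat j - of_nat k) * h * x) - 1))"
    unfolding power_eq using int by simp
qed

lemma integrable_if_LIMSEQ_integral_bounded:
  fixes q :: "nat \<Rightarrow> 'a \<Rightarrow> real"
  assumes int: "\<And>n. integrable M (q n)" and nonneg: "\<And>n x. 0 \<le> q n x"
    and lim: "\<And>x. (\<lambda>n. q n x) \<longlonglongrightarrow> f x"
    and bound: "\<forall>\<^sub>F n in sequentially. integral\<^sup>L M (q n) \<le> C"
  shows "integrable M f"
proof (rule integrableI_nonneg)
  have [measurable]: "q n \<in> borel_measurable M" for n
    using int by (rule borel_measurable_integrable)
  show "f \<in> borel_measurable M"
    using lim by (rule borel_measurable_LIMSEQ_real) measurable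
  show "AE x in M. 0 \<le> f x"
    using LIMSEQ_le_const[OF lim] nonneg by blast
  have "(\<integral>\<^sup>+x. ennreal (f x) \<partial>M) = (\<integral>\<^sup>+x. liminf (\<lambda>n. ennreal (q n x)) \<partial>M)"
    using tendsto_ennrealI[OF lim] by (intro nn_integral_cong lim_imp_Liminf[symmetric]) auto
  also have "\<dots> \<le> liminf (\<lambda>n. \<integral>\<^sup>+x. ennreal (q n x) \<partial>M)"
    by (rule nn_integral_liminf) measurable
  also have "\<dots> \<le> liminf (\<lambda>n. ennreal C)"
    using bound nonneg int
    by (intro Liminf_mono) (auto simp: nn_integral_eq_integral intro: ennreal_leI elim: eventually_mono)
  also have "\<dots> < \<infinity>"
    by (simp add: Liminf_const)
  finally show "(\<integral>\<^sup>+x. ennreal (f x) \<partial>M) < \<infinity>" .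
qed

text \<open>The central difference of order \<open>2 * k\<close> of \<open>u \<mapsto> cos (u * x) - 1\<close> with step \<open>h\<close> is
  \<open>(-1) ^ k * (2 - 2 * cos (h * x)) ^ k\<close>, so the \<open>\<nu>\<close>-integral of \<open>((2 - 2 * cos (h * x)) / h\<^sup>2) ^ k\<close>
  stays bounded as \<open>h\<close> tends to 0, while the integrand tends to \<open>x ^ (2 * k)\<close>.\<close>
lemma integrable_even_power_if_asym_expansion:
  assumes int: "\<And>u. integrable \<nu> (\<lambda>x. cos (u * x) - 1)"
    and expansion: "asym_expansion (\<lambda>u. LINT x|\<nu>. cos (u * x) - 1) A"
    and k: "k \<ge> 1"
  shows "integrable \<nu> (\<lambda>x. x ^ (2 * k))"
proof -
  let ?I = "\<lambda>h. LINT x|\<nu>. (2 - 2 * cos (h * x)) ^ k"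
  have "?I \<in> O[nhds 0](\<lambda>h. h ^ (2 * k))"
    unfolding lebesgue_integral_two_minus_two_cos_power[OF int k]
    using asym_expansion_finite_difference_bigo[OF expansion, of "2 * k" "real k"] by simp
  then obtain C where "\<forall>\<^sub>F h in nhds 0. norm (?I h) \<le> C * norm (h ^ (2 * k))"
    by (rule landau_o.bigE)
  then have bound: "\<forall>\<^sub>F h in nhds 0. ?I h \<le> C * h ^ (2 * k)"
    by (rule eventually_mono) auto
  define h where "h n = inverse (real (Suc n))" for n
  have h_pos: "h n > 0" for n by (simp add: h_def)
  have h_lim: "h \<longlonglongrightarrow> 0" unfolding h_def by (rule LIMSEQ_inverse_real_of_nat)
  then have h_at: "filterlim h (at 0) sequentially"
    using h_pos by (auto simp: filterlim_at h_def)
  show ?thesis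
  proof (rule integrable_if_LIMSEQ_integral_bounded)
    let ?q = "\<lambda>n x. ((2 - 2 * cos (h n * x)) / (h n)\<^sup>2) ^ k"
    show "integrable \<nu> (?q n)" for n
      unfolding power_divide by (intro integrable_divide integrable_two_minus_two_cos_power int k)
    show "0 \<le> ?q n x" for n x
      by (rule zero_le_power, rule divide_nonneg_nonneg) auto
    show "(\<lambda>n. ?q n x) \<longlonglongrightarrow> x ^ (2 * k)" for x
      by (rule filterlim_compose[OF tendsto_two_minus_two_cos_power h_at])
    show "\<forall>\<^sub>F n in sequentially. (LINT x|\<nu>. ?q n x) \<le> C"
      using eventually_compose_filterlim[OF bound h_lim]
    proof eventually_elim
      case (elim n)
      then show ?case
        using h_pos[of n] by (simp add: power_divide pos_divide_le_eq power_mult)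
    qed
  qed
qed

section \<open>Cumulants from the Levy-Khintchine formula\<close>

definition fps_twist :: "'a \<Rightarrow> real fps \<Rightarrow> 'a::real_normed_field fps" where
  "fps_twist c A = Abs_fps (\<lambda>n. c ^ n * of_real (fps_nth A n))"

lemma fps_twist_nth [simp]: "fps_nth (fps_twist c A) n = c ^ n * of_real (fps_nth A n)"
  by (simp add: fps_twist_def)

lemma fps_twist_eq_iff: "c \<noteq> 0 \<Longrightarrow> fps_twist c A = fps_twist c B \<longleftrightarrow> A = B"
  by (simp add: fps_eq_iff)

lemma fps_twist_mult: "fps_twist c (A * B) = fps_twist c A * fps_twist c B"
proof (rule fps_ext)
  fix n
  have "c ^ n = c ^ i * c ^ (n - i)" if "i \<le> n" for i
    using that by (simp flip: power_add)
  then show "fps_nth (fps_twist c (A * B)) n = fps_nth (fps_twist c A * fps_twist c B) n"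
    by (simp add: fps_mult_nth sum_distrib_left mult_ac)
qed

lemma fps_twist_power: "fps_twist c (A ^ k) = fps_twist c A ^ k"
proof (induction k)
  case 0
  show ?case by (simp add: fps_eq_iff)
qed (simp add: fps_twist_mult)

lemma fps_twist_exp_compose: "fps_twist c (fps_exp 1 oo A) = fps_exp 1 oo fps_twist c A"
proof (rule fps_ext)
  fix n
  have "fps_nth (fps_twist c A ^ k) n = c ^ n * of_real (fps_nth (A ^ k) n)" for k
    by (simp flip: fps_twist_power)
  then show "fps_nth (fps_twist c (fps_exp 1 oo A)) n = fps_nth (fps_exp 1 oo fps_twist c A) n"
    by (simp add: fps_compose_nth sum_distrib_left mult_ac)
qed

definition moment_fps :: "'a measure \<Rightarrow> ('a \<Rightarrow> real) \<Rightarrow> real fps" where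
  "moment_fps M X = Abs_fps (\<lambda>n. (LINT \<omega>|M. X \<omega> ^ n) / fact n)"

lemma moment_fps_nth [simp]: "fps_nth (moment_fps M X) n = (LINT \<omega>|M. X \<omega> ^ n) / fact n"
  by (simp add: moment_fps_def)

definition iexp_remainder :: "nat \<Rightarrow> real \<Rightarrow> complex" where
  "iexp_remainder N y = iexp y - (\<Sum>j<N. (\<i> * of_real y) ^ j / fact j)"

lemma borel_measurable_iexp_remainder [measurable]: "iexp_remainder N \<in> borel_measurable borel"
  unfolding iexp_remainder_def by measurable

lemma norm_iexp_remainder_le: "norm (iexp_remainder N y) \<le> \<bar>y\<bar> ^ N / fact N"
  using iexp_approx1[of y "N - 1"]
  by (cases N) (simp_all add: iexp_remainder_def lessThan_Suc_atMost)

lemma iexp_remainder_eq: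
  assumes "m \<le> N"
  shows "iexp_remainder m y = (\<Sum>j\<in>{m..<N}. (\<i> * of_real y) ^ j / fact j) + iexp_remainder N y"
  unfolding iexp_remainder_def lessThan_atLeast0 sum.atLeastLessThan_concat[OF le0 assms, symmetric]
  by simp

lemma integrable_iexp_remainder:
  fixes \<nu> :: "real measure"
  assumes [measurable_cong]: "sets \<nu> = sets borel" and int: "integrable \<nu> (\<lambda>x. x ^ N)"
  shows "integrable \<nu> (\<lambda>x. iexp_remainder N (u * x))"
proof (rule Bochner_Integration.integrable_bound)
  show "integrable \<nu> (\<lambda>x. u ^ N / fact N * x ^ N)"
    by (intro integrable_mult_right int)
  show "AE x in \<nu>. norm (iexp_remainder N (u * x)) \<le> norm (u ^ N / fact N * x ^ N)"
    by (intro AE_I2 order.trans[OF norm_iexp_remainder_le])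
       (simp add: abs_mult power_abs power_mult_distrib)
qed measurable

lemma norm_integral_iexp_remainder_le:
  fixes \<nu> :: "real measure"
  assumes "sets \<nu> = sets borel" and int: "integrable \<nu> (\<lambda>x. x ^ N)"
  shows "norm (CLINT x|\<nu>. iexp_remainder N (u * x)) \<le> (LINT x|\<nu>. \<bar>x\<bar> ^ N) / fact N * \<bar>u\<bar> ^ N"
proof -
  have "norm (CLINT x|\<nu>. iexp_remainder N (u * x)) \<le> (LINT x|\<nu>. norm (iexp_remainder N (u * x)))"
    by (rule integral_norm_bound)
  also have "\<dots> \<le> (LINT x|\<nu>. \<bar>u\<bar> ^ N / fact N * \<bar>x\<bar> ^ N)"
  proof (rule integral_mono)
    show "integrable \<nu> (\<lambda>x. norm (iexp_remainder N (u * x)))"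
      by (intro integrable_norm integrable_iexp_remainder assms)
    show "integrable \<nu> (\<lambda>x. \<bar>u\<bar> ^ N / fact N * \<bar>x\<bar> ^ N)"
      using integrable_abs[OF int] by (intro integrable_mult_right) (simp add: power_abs)
    show "norm (iexp_remainder N (u * x)) \<le> \<bar>u\<bar> ^ N / fact N * \<bar>x\<bar> ^ N" for x
      using norm_iexp_remainder_le[of N "u * x"] by (simp add: abs_mult power_mult_distrib)
  qed
  finally show ?thesis by (simp add: mult.commute)
qed

lemma integral_iexp_remainder_eq:
  fixes \<nu> :: "real measure"
  assumes sets: "sets \<nu> = sets borel" and int: "\<And>n. n \<ge> m \<Longrightarrow> integrable \<nu> (\<lambda>x. x ^ n)" and "m \<le> N"
  shows "(CLINT x|\<nu>. iexp_remainder m (u * x))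
    = (\<Sum>j\<in>{m..<N}. \<i> ^ j * of_real ((LINT x|\<nu>. x ^ j) / fact j) * of_real u ^ j)
        + (CLINT x|\<nu>. iexp_remainder N (u * x))"
proof -
  have int_term: "integrable \<nu> (\<lambda>x. (\<i> * of_real u) ^ j / fact j * complex_of_real (x ^ j))"
    if "j \<ge> m" for j
    using int[OF that] by (intro integrable_mult_right integrable_of_real)
  have "(CLINT x|\<nu>. iexp_remainder m (u * x))
      = (CLINT x|\<nu>. (\<Sum>j\<in>{m..<N}. (\<i> * of_real u) ^ j / fact j * complex_of_real (x ^ j))
          + iexp_remainder N (u * x))"
    unfolding iexp_remainder_eq[OF \<open>m \<le> N\<close>] by (simp add: power_mult_distrib mult_ac)
  also have "\<dots> = (CLINT x|\<nu>. \<Sum>j\<in>{m..<N}. (\<i> * of_real u) ^ j / fact j * complex_of_real (x ^ j))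
      + (CLINT x|\<nu>. iexp_remainder N (u * x))"
    by (intro Bochner_Integration.integral_add Bochner_Integration.integrable_sum int_term
        integrable_iexp_remainder sets int \<open>m \<le> N\<close>) simp
  also have "(CLINT x|\<nu>. \<Sum>j\<in>{m..<N}. (\<i> * of_real u) ^ j / fact j * complex_of_real (x ^ j))
      = (\<Sum>j\<in>{m..<N}. CLINT x|\<nu>. (\<i> * of_real u) ^ j / fact j * complex_of_real (x ^ j))"
    by (rule Bochner_Integration.integral_sum) (rule int_term, simp)
  also have "\<dots> = (\<Sum>j\<in>{m..<N}. \<i> ^ j * of_real ((LINT x|\<nu>. x ^ j) / fact j) * of_real u ^ j)"
    by (simp add: power_mult_distrib mult_ac del: of_real_power)
  finally show ?thesis .
qed

lemma asym_expansion_integral_iexp_remainder: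
  fixes \<nu> :: "real measure"
  assumes sets: "sets \<nu> = sets borel" and int: "\<And>n. n \<ge> m \<Longrightarrow> integrable \<nu> (\<lambda>x. x ^ n)"
  shows "asym_expansion (\<lambda>u. CLINT x|\<nu>. iexp_remainder m (u * x))
           (fps_twist \<i> (moment_fps \<nu> (\<lambda>x. x) - fps_cutoff m (moment_fps \<nu> (\<lambda>x. x))))"
    (is "asym_expansion ?f ?A")
  unfolding asym_expansion_def
proof
  fix N
  have bigo: "(\<lambda>u. CLINT x|\<nu>. iexp_remainder n (u * x)) \<in> O[nhds 0](\<lambda>u. of_real u ^ n)" if "n \<ge> m" for n
    using norm_integral_iexp_remainder_le[OF sets int[OF that]]
    by (intro bigoI[where c = "(LINT x|\<nu>. \<bar>x\<bar> ^ n) / fact n"]) (simp add: norm_power)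
  show "(\<lambda>u. ?f u - (\<Sum>j<N. fps_nth ?A j * of_real u ^ j)) \<in> O[nhds 0](\<lambda>u. of_real u ^ N)"
  proof (cases "m \<le> N")
    case True
    have "(\<Sum>j<N. fps_nth ?A j * of_real u ^ j)
        = (\<Sum>j\<in>{m..<N}. \<i> ^ j * of_real ((LINT x|\<nu>. x ^ j) / fact j) * of_real u ^ j)" for u
      using True by (intro sum.mono_neutral_cong_right) auto
    then show ?thesis
      using bigo[OF True] integral_iexp_remainder_eq[OF sets int True] by simp
  next
    case False
    then have "(\<Sum>j<N. fps_nth ?A j * of_real u ^ j) = 0" for u
      by (intro sum.neutral) auto
    then show ?thesis
      using landau_o.big.trans[OF bigo[OF order.refl] of_real_power_bigo_mono[of N m]] False by simp
  qed
qed

lemma (in real_distribution) asym_expansion_char: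
  assumes "\<And>k. integrable M (\<lambda>x. x ^ k)"
  shows "asym_expansion (char M) (fps_twist \<i> (moment_fps M (\<lambda>x. x)))"
  using asym_expansion_integral_iexp_remainder[of M 0] assms
  by (simp add: iexp_remainder_def char_def[abs_def])

definition levy_khintchine_kernel :: "real \<Rightarrow> real \<Rightarrow> complex" where
  "levy_khintchine_kernel u x = iexp (u * x) - 1 - \<i> * complex_of_real (u * x * indicator {-1..1} x)"

lemma borel_measurable_levy_khintchine_kernel [measurable]:
  "levy_khintchine_kernel u \<in> borel_measurable borel"
  unfolding levy_khintchine_kernel_def[abs_def] by measurable

lemma levy_khintchine_kernel_eq:
  "levy_khintchine_kernel u x
     = iexp_remainder 2 (u * x) + \<i> * of_real u * complex_of_real (x * indicator (- {-1..1}) x)"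
  by (simp add: levy_khintchine_kernel_def iexp_remainder_def numeral_2_eq_2 indicator_def)

lemma Re_levy_khintchine_kernel: "Re (levy_khintchine_kernel u x) = cos (u * x) - 1"
  by (simp add: levy_khintchine_kernel_def Re_exp)

lemma norm_levy_khintchine_kernel_le: "norm (levy_khintchine_kernel u x) \<le> (2 + u\<^sup>2) * min 1 (x\<^sup>2)"
proof (cases "x \<in> {-1..1}")
  case True
  then have "norm (levy_khintchine_kernel u x) \<le> \<bar>u * x\<bar> ^ 2 / 2"
    using norm_iexp_remainder_le[of 2 "u * x"] by (simp add: levy_khintchine_kernel_eq)
  also have "\<dots> \<le> (2 + u\<^sup>2) * x\<^sup>2"
    by (simp add: power_mult_distrib algebra_simps)
  finally show ?thesis
    using True by (simp add: abs_square_le_1 abs_le_iff)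
next
  case False
  have "norm (iexp (u * x) - 1) \<le> norm (iexp (u * x)) + norm (1 :: complex)"
    by (rule norm_triangle_ineq4)
  also have "\<dots> \<le> 2 + u\<^sup>2" by simp
  finally show ?thesis
    using False abs_square_le_1[of x] by (auto simp: levy_khintchine_kernel_def abs_le_iff min_def)
qed

lemma integrable_levy_khintchine_kernel:
  assumes [measurable_cong]: "sets \<nu> = sets borel" and int: "integrable \<nu> (\<lambda>x. min 1 (x\<^sup>2))"
  shows "integrable \<nu> (levy_khintchine_kernel u)"
proof (rule Bochner_Integration.integrable_bound)
  show "integrable \<nu> (\<lambda>x. (2 + u\<^sup>2) * min 1 (x\<^sup>2))"
    by (intro integrable_mult_right int)
  show "AE x in \<nu>. norm (levy_khintchine_kernel u x) \<le> norm ((2 + u\<^sup>2) * min 1 (x\<^sup>2))"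
    using order.trans[OF norm_levy_khintchine_kernel_le abs_ge_self]
    by (intro AE_I2) (simp only: real_norm_def)
qed measurable

lemma levy_khintchineE:
  assumes "levy_khintchine \<mu> \<sigma>2 \<nu>"
  obtains b where "sets \<nu> = sets borel" "\<And>u. integrable \<nu> (levy_khintchine_kernel u)"
    and "\<And>u. char \<mu> u = exp (\<i> * of_real (b * u) - of_real (\<sigma>2 * u\<^sup>2 / 2)
           + (CLINT x|\<nu>. levy_khintchine_kernel u x))"
  using assms integrable_levy_khintchine_kernel[of \<nu>] that
  unfolding levy_khintchine_def levy_khintchine_kernel_def[abs_def] by blast

lemma integrable_cos_minus_1_levy_measure:
  assumes "levy_khintchine \<mu> \<sigma>2 \<nu>"
  shows "integrable \<nu> (\<lambda>x. cos (u * x) - 1)"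
proof -
  have "integrable \<nu> (levy_khintchine_kernel u)"
    using assms by (intro integrable_levy_khintchine_kernel) (simp_all add: levy_khintchine_def)
  from integrable_Re[OF this] show ?thesis
    by (simp add: Re_levy_khintchine_kernel)
qed

lemma ln_cmod_char_levy_khintchine:
  assumes "levy_khintchine \<mu> \<sigma>2 \<nu>"
  shows "ln (cmod (char \<mu> u)) = (LINT x|\<nu>. cos (u * x) - 1) - \<sigma>2 / 2 * u\<^sup>2"
proof -
  obtain b where int: "integrable \<nu> (levy_khintchine_kernel u)"
    and char: "char \<mu> u = exp (\<i> * of_real (b * u) - of_real (\<sigma>2 * u\<^sup>2 / 2)
        + (CLINT x|\<nu>. levy_khintchine_kernel u x))"
    using assms by (rule levy_khintchineE) blast
  have "Re (CLINT x|\<nu>. levy_khintchine_kernel u x) = (LINT x|\<nu>. cos (u * x) - 1)"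
    by (simp add: integral_Re[OF int, symmetric] Re_levy_khintchine_kernel)
  then show ?thesis
    by (simp add: char norm_exp_eq_Re)
qed

lemma abs_power_le_square_plus_power:
  fixes x :: real
  assumes "2 \<le> n" "n \<le> m"
  shows "\<bar>x\<bar> ^ n \<le> \<bar>x\<bar> ^ 2 + \<bar>x\<bar> ^ m"
proof (cases "\<bar>x\<bar> \<le> 1")
  case True
  then have "\<bar>x\<bar> ^ n \<le> \<bar>x\<bar> ^ 2" using assms by (intro power_decreasing) auto
  also have "\<dots> \<le> \<bar>x\<bar> ^ 2 + \<bar>x\<bar> ^ m" by simp
  finally show ?thesis .
next
  case False
  then have "\<bar>x\<bar> ^ n \<le> \<bar>x\<bar> ^ m" using assms by (intro power_increasing) auto
  also have "\<dots> \<le> \<bar>x\<bar> ^ 2 + \<bar>x\<bar> ^ m" by simp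
  finally show ?thesis .
qed

lemma (in real_distribution) integrable_power_levy_measure:
  assumes moments: "\<And>k. integrable M (\<lambda>x. x ^ k)"
    and LK: "levy_khintchine M \<sigma>2 \<nu>"
    and n: "n \<ge> 2"
  shows "integrable \<nu> (\<lambda>x. x ^ n)"
proof -
  have sets [measurable_cong]: "sets \<nu> = sets borel"
    using LK by (simp add: levy_khintchine_def)
  have "fps_nth (fps_twist \<i> (moment_fps M (\<lambda>x. x))) 0 = 1"
    using prob_space by simp
  with asym_expansion_char[OF moments]
  obtain B where "asym_expansion (\<lambda>u. ln (cmod (char M u))) B"
    by (rule asym_expansion_ln_cmod)
  then have "asym_expansion (\<lambda>u. ln (cmod (char M u)) + \<sigma>2 / 2 * of_real u ^ 2)
      (B + fps_const (\<sigma>2 / 2) * fps_X ^ 2)"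
    by (intro asym_expansion_add asym_expansion_cmult
        has_fps_expansion_imp_asym_expansion has_fps_expansion_fps_X_power)
  then have "asym_expansion (\<lambda>u. LINT x|\<nu>. cos (u * x) - 1) (B + fps_const (\<sigma>2 / 2) * fps_X ^ 2)"
    by (simp add: ln_cmod_char_levy_khintchine[OF LK])
  note even = integrable_even_power_if_asym_expansion[OF integrable_cos_minus_1_levy_measure[OF LK] this]
  show ?thesis
  proof (rule Bochner_Integration.integrable_bound)
    show "integrable \<nu> (\<lambda>x. x ^ (2 * 1) + x ^ (2 * n))"
      using n by (intro Bochner_Integration.integrable_add even) auto
    show "AE x in \<nu>. norm (x ^ n) \<le> norm (x ^ (2 * 1) + x ^ (2 * n))"
      using abs_power_le_square_plus_power[of n "2 * n"] n
      by (intro AE_I2) (simp add: power_abs[symmetric] power_mult)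
  qed measurable
qed

definition levy_cumulant :: "real \<Rightarrow> real measure \<Rightarrow> nat \<Rightarrow> real" where
  "levy_cumulant \<sigma>2 \<nu> k = (if k = 2 then \<sigma>2 else 0) + (LINT x|\<nu>. x ^ k)"

definition cumulant_fps :: "(nat \<Rightarrow> real) \<Rightarrow> real fps" where
  "cumulant_fps \<kappa> = Abs_fps (\<lambda>k. if k < 2 then 0 else \<kappa> k / fact k)"

lemma integral_levy_khintchine_kernel:
  assumes sets [measurable_cong]: "sets \<nu> = sets borel" and int: "integrable \<nu> (\<lambda>x. x ^ 2)"
  shows "(CLINT x|\<nu>. levy_khintchine_kernel u x) = (CLINT x|\<nu>. iexp_remainder 2 (u * x))
    + \<i> * of_real u * of_real (LINT x|\<nu>. x * indicator (- {-1..1}) x)"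
proof -
  have int_tail: "integrable \<nu> (\<lambda>x. x * indicator (- {-1..1}) x :: real)"
  proof (rule Bochner_Integration.integrable_bound[OF int])
    have "\<bar>x\<bar> \<le> x ^ 2" if "x \<notin> {-1..1}" for x :: real
      using that power_increasing[of 1 2 "\<bar>x\<bar>"] by (auto simp: abs_if split: if_splits)
    then show "AE x in \<nu>. norm (x * indicator (- {-1..1}) x :: real) \<le> norm (x ^ 2)"
      by (intro AE_I2) (auto simp: indicator_def)
  qed measurable
  show ?thesis
    unfolding levy_khintchine_kernel_eq
    using integrable_iexp_remainder[OF sets int] int_tail
    by (subst Bochner_Integration.integral_add)
       (auto simp only: integral_mult_right_zero integral_complex_of_real
         intro: integrable_mult_right integrable_of_real)
qed

lemma asym_expansion_char_levy_khintchine: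
  assumes LK: "levy_khintchine \<mu> \<sigma>2 \<nu>" and int: "\<And>n. n \<ge> 2 \<Longrightarrow> integrable \<nu> (\<lambda>x. x ^ n)"
  obtains \<beta> where "asym_expansion (char \<mu>)
    (fps_exp 1 oo fps_twist \<i> (fps_const \<beta> * fps_X + cumulant_fps (levy_cumulant \<sigma>2 \<nu>)))"
proof -
  obtain b where sets: "sets \<nu> = sets borel"
    and char: "\<And>u. char \<mu> u = exp (\<i> * of_real (b * u) - of_real (\<sigma>2 * u\<^sup>2 / 2)
        + (CLINT x|\<nu>. levy_khintchine_kernel u x))"
    using LK by (rule levy_khintchineE) blast
  define \<beta> where "\<beta> = b + (LINT x|\<nu>. x * indicator (- {-1..1}) x)"
  define K where "K = fps_const \<beta> * fps_X + cumulant_fps (levy_cumulant \<sigma>2 \<nu>)"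
  let ?T = "moment_fps \<nu> (\<lambda>x. x) - fps_cutoff 2 (moment_fps \<nu> (\<lambda>x. x))"
  have char_eq: "char \<mu> u = exp (\<i> * of_real \<beta> * of_real u + (- (of_real \<sigma>2 / 2)) * of_real u ^ 2
      + (CLINT x|\<nu>. iexp_remainder 2 (u * x)))" for u
    unfolding char integral_levy_khintchine_kernel[OF sets int[OF order.refl]]
    by (rule arg_cong[where f = exp]) (simp add: \<beta>_def algebra_simps)
  have "asym_expansion (\<lambda>u. \<i> * of_real \<beta> * of_real u + (- (of_real \<sigma>2 / 2)) * of_real u ^ 2
        + (CLINT x|\<nu>. iexp_remainder 2 (u * x)))
      (fps_const (\<i> * of_real \<beta>) * fps_X + fps_const (- (of_real \<sigma>2 / 2)) * fps_X ^ 2 + fps_twist \<i> ?T)"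
    by (intro asym_expansion_add asym_expansion_cmult has_fps_expansion_imp_asym_expansion
        has_fps_expansion_fps_X has_fps_expansion_fps_X_power
        asym_expansion_integral_iexp_remainder sets int)
  moreover have "fps_const (\<i> * of_real \<beta>) * fps_X + fps_const (- (of_real \<sigma>2 / 2)) * fps_X ^ 2
      + fps_twist \<i> ?T = fps_twist \<i> K"
    by (auto simp: fps_eq_iff K_def cumulant_fps_def levy_cumulant_def le_Suc_eq)
  ultimately have "asym_expansion (char \<mu>) (fps_exp 1 oo fps_twist \<i> K)"
    unfolding char_eq[abs_def]
    by (intro asym_expansion_compose[OF _ _ has_fps_expansion_exp1])
       (simp_all add: K_def cumulant_fps_def)
  then show thesis
    unfolding K_def by (rule that)
qed

lemma (in real_distribution) moment_fps_levy_khintchine: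
  assumes moments: "\<And>k. integrable M (\<lambda>x. x ^ k)"
    and LK: "levy_khintchine M \<sigma>2 \<nu>"
  shows "moment_fps M (\<lambda>x. x)
    = fps_exp 1 oo (fps_const (expectation (\<lambda>x. x)) * fps_X + cumulant_fps (levy_cumulant \<sigma>2 \<nu>))"
proof -
  let ?K = "\<lambda>\<beta>. fps_const \<beta> * fps_X + cumulant_fps (levy_cumulant \<sigma>2 \<nu>)"
  obtain \<beta> where "asym_expansion (char M) (fps_exp 1 oo fps_twist \<i> (?K \<beta>))"
    using LK integrable_power_levy_measure[OF moments LK] by (rule asym_expansion_char_levy_khintchine)
  then have "fps_twist \<i> (moment_fps M (\<lambda>x. x)) = fps_twist \<i> (fps_exp 1 oo ?K \<beta>)"
    unfolding fps_twist_exp_compose by (rule asym_expansion_unique[OF asym_expansion_char[OF moments]])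
  then have moment_fps: "moment_fps M (\<lambda>x. x) = fps_exp 1 oo ?K \<beta>"
    by (simp add: fps_twist_eq_iff)
  \<comment> \<open>The drift is not normalised in the representation; the mean determines it.\<close>
  have "expectation (\<lambda>x. x) = \<beta>"
    using arg_cong[OF moment_fps, of "\<lambda>A. fps_nth A 1"]
    by (simp add: fps_compose_nth cumulant_fps_def)
  then show ?thesis
    using moment_fps by simp
qed

lemma (in prob_space) moment_fps_centred_levy_khintchine:
  assumes X: "random_variable borel X" and moments: "\<And>k. integrable M (\<lambda>\<omega>. X \<omega> ^ k)"
    and mean: "expectation X = 0" and LK: "levy_khintchine (distr M borel X) \<sigma>2 \<nu>"
  shows "moment_fps M X = fps_exp 1 oo cumulant_fps (levy_cumulant \<sigma>2 \<nu>)"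
proof -
  interpret \<mu>: real_distribution "distr M borel X"
    using X by (rule real_distribution_distr)
  have integral_distr: "(LINT x|distr M borel X. x ^ k) = (LINT \<omega>|M. X \<omega> ^ k)" for k
    using X by (simp add: integral_distr)
  have "moment_fps M X = moment_fps (distr M borel X) (\<lambda>x. x)"
    by (simp add: moment_fps_def integral_distr)
  also have "\<dots> = fps_exp 1 oo
      (fps_const (\<mu>.expectation (\<lambda>x. x)) * fps_X + cumulant_fps (levy_cumulant \<sigma>2 \<nu>))"
    using X moments by (intro \<mu>.moment_fps_levy_khintchine LK) (simp add: integrable_distr_eq)
  also have "\<mu>.expectation (\<lambda>x. x) = 0"
    using integral_distr[of 1] mean by simp
  finally show ?thesis by simp
qed

section \<open>Independent increments\<close>

definition (in prob_space) independent_increments :: "(real \<Rightarrow> 'a \<Rightarrow> real) \<Rightarrow> bool" where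
  "independent_increments X \<longleftrightarrow> (\<forall>ts. sorted_wrt (<) ts \<longrightarrow> (\<forall>t\<in>set ts. t \<ge> 0) \<longrightarrow>
     indep_vars (\<lambda>_. borel) (\<lambda>i \<omega>. X (ts ! Suc i) \<omega> - X (ts ! i) \<omega>) {..<length ts - 1})"

lemma (in prob_space) indep_set_mono:
  "indep_set A B \<Longrightarrow> A' \<subseteq> A \<Longrightarrow> B' \<subseteq> B \<Longrightarrow> indep_set A' B'"
  unfolding indep_sets2_eq by blast

text \<open>\<open>indep_var\<close> does not cover this notion, as it forces both variables to take values in the
  same type.\<close>
definition (in prob_space) indep_algebra_var :: "'a measure \<Rightarrow> 'b measure \<Rightarrow> ('a \<Rightarrow> 'b) \<Rightarrow> bool" where
  "indep_algebra_var F T Y \<longleftrightarrow> indep_set (sets F) (sets (vimage_algebra (space M) Y T))"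

lemma (in prob_space) indep_algebra_var_vimage_compose:
  assumes indep: "indep_var S X T Y" and g: "g \<in> S \<rightarrow>\<^sub>M S'" and h: "h \<in> T \<rightarrow>\<^sub>M T'"
  shows "indep_algebra_var (vimage_algebra (space M) (\<lambda>\<omega>. g (X \<omega>)) S') T' (\<lambda>\<omega>. h (Y \<omega>))"
proof -
  have X: "random_variable S X" and Y: "random_variable T Y"
    and indep_sets: "indep_set (sets (vimage_algebra (space M) X S)) (sets (vimage_algebra (space M) Y T))"
    using indep by (simp_all add: indep_var_eq sets_vimage_algebra)
  have "X \<in> vimage_algebra (space M) X S \<rightarrow>\<^sub>M S" "Y \<in> vimage_algebra (space M) Y T \<rightarrow>\<^sub>M T"
    using measurable_space[OF X] measurable_space[OF Y] by (auto intro: measurable_vimage_algebra1)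
  then have "sets (vimage_algebra (space M) (\<lambda>\<omega>. g (X \<omega>)) S') \<subseteq> sets (vimage_algebra (space M) X S)"
    and "sets (vimage_algebra (space M) (\<lambda>\<omega>. h (Y \<omega>)) T') \<subseteq> sets (vimage_algebra (space M) Y T)"
    by (intro sets_image_in_sets measurable_compose[OF _ g] measurable_compose[OF _ h]; simp)+
  then show ?thesis
    unfolding indep_algebra_var_def by (rule indep_set_mono[OF indep_sets])
qed

lemma (in prob_space) indep_algebra_var_vimage_cong_AE:
  assumes indep: "indep_algebra_var (vimage_algebra (space M) X S) T Y"
    and AE: "AE \<omega> in M. X \<omega> = X' \<omega>" and X: "random_variable S X" and X': "random_variable S X'"
  shows "indep_algebra_var (vimage_algebra (space M) X' S) T Y"
  unfolding indep_algebra_var_def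
proof (rule indep_setI)
  let ?B = "sets (vimage_algebra (space M) Y T)"
  have indep_sets: "indep_set (sets (vimage_algebra (space M) X S)) ?B"
    using indep by (simp add: indep_algebra_var_def)
  then show B: "?B \<subseteq> events"
    by (simp add: indep_sets2_eq)
  show "sets (vimage_algebra (space M) X' S) \<subseteq> events"
    by (rule sets_image_in_sets[OF refl X'])
  fix a b assume "a \<in> sets (vimage_algebra (space M) X' S)" and b: "b \<in> ?B"
  then obtain A where A: "A \<in> sets S" and a: "a = X' -` A \<inter> space M"
    using measurable_space[OF X'] by (auto simp: sets_vimage_algebra2)
  let ?a = "X -` A \<inter> space M"
  have AE_a: "AE \<omega> in M. \<omega> \<in> a \<longleftrightarrow> \<omega> \<in> ?a"
    using AE by eventually_elim (simp add: a)
  have events: "a \<in> events" "?a \<in> events" "b \<in> events"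
    using A b B by (auto simp: a measurable_sets[OF X] measurable_sets[OF X'])
  have "prob (a \<inter> b) = prob (?a \<inter> b)"
    using AE_a events by (intro finite_measure_eq_AE) auto
  also have "\<dots> = prob ?a * prob b"
    using b A by (intro indep_setD[OF indep_sets] in_vimage_algebra)
  also have "prob ?a = prob a"
    using AE_a events by (intro finite_measure_eq_AE) auto
  finally show "prob (a \<inter> b) = prob a * prob b" .
qed

lemma (in prob_space) indep_algebra_var_sorted_increments:
  assumes incr: "independent_increments X"
    and ts: "sorted_wrt (<) (ts @ [t])" "\<forall>r\<in>set (ts @ [t]). 0 \<le> r"
    and "ts \<noteq> []"
    and g: "g \<in> Pi\<^sub>M {..<length ts} (\<lambda>_. borel) \<rightarrow>\<^sub>M S"
  shows "indep_algebra_var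
           (vimage_algebra (space M) (\<lambda>\<omega>. g (\<lambda>i\<in>{..<length ts}. X (ts ! i) \<omega> - X (ts ! 0) \<omega>)) S)
           borel (\<lambda>\<omega>. X t \<omega> - X (last ts) \<omega>)"
proof -
  obtain m where m: "length ts = Suc m"
    using \<open>ts \<noteq> []\<close> by (cases ts) auto
  define Y where "Y i \<omega> = X ((ts @ [t]) ! Suc i) \<omega> - X ((ts @ [t]) ! i) \<omega>" for i \<omega>
  define cumulate where "cumulate f = (\<lambda>i\<in>{..<length ts}. \<Sum>l<i. f l)" for f :: "nat \<Rightarrow> real"
  have "indep_vars (\<lambda>_. borel) Y {..<Suc m}"
    using incr ts m unfolding independent_increments_def Y_def[abs_def] by fastforce
  then have indep: "indep_var (Pi\<^sub>M {..<m} (\<lambda>_. borel)) (\<lambda>\<omega>. \<lambda>i\<in>{..<m}. Y i \<omega>)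
      (Pi\<^sub>M {m} (\<lambda>_. borel)) (\<lambda>\<omega>. \<lambda>i\<in>{m}. Y i \<omega>)"
    by (rule indep_var_restrict) auto
  have cumulate: "cumulate \<in> Pi\<^sub>M {..<m} (\<lambda>_. borel) \<rightarrow>\<^sub>M Pi\<^sub>M {..<length ts} (\<lambda>_. borel)"
    unfolding cumulate_def
    by (intro measurable_restrict borel_measurable_sum measurable_component_singleton) (auto simp: m)
  have eval: "(\<lambda>f. f m) \<in> Pi\<^sub>M {m} (\<lambda>_. borel) \<rightarrow>\<^sub>M (borel :: real measure)"
    by (rule measurable_component_singleton) simp
  have telescope: "(\<Sum>l<i. (\<lambda>i\<in>{..<m}. Y i \<omega>) l) = X (ts ! i) \<omega> - X (ts ! 0) \<omega>"
    if "i < length ts" for i \<omega>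
  proof -
    have "(\<Sum>l<i. (\<lambda>i\<in>{..<m}. Y i \<omega>) l) = (\<Sum>l<i. X (ts ! Suc l) \<omega> - X (ts ! l) \<omega>)"
      using that by (intro sum.cong) (auto simp: Y_def nth_append m)
    then show ?thesis
      using sum_lessThan_telescope[of "\<lambda>l. X (ts ! l) \<omega>" i] by simp
  qed
  have "cumulate (\<lambda>i\<in>{..<m}. Y i \<omega>) = (\<lambda>i\<in>{..<length ts}. X (ts ! i) \<omega> - X (ts ! 0) \<omega>)" for \<omega>
    unfolding cumulate_def by (rule restrict_ext) (simp only: telescope lessThan_iff)
  moreover have "Y m \<omega> = X t \<omega> - X (last ts) \<omega>" for \<omega>
    using \<open>ts \<noteq> []\<close> m by (simp add: Y_def nth_append last_conv_nth)
  ultimately show ?thesis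
    using indep_algebra_var_vimage_compose[OF indep measurable_compose[OF cumulate g] eval] by simp
qed

lemma last_eq_if_sorted_wrt_less:
  fixes xs :: "'a::order list"
  assumes "sorted_wrt (<) xs" "x \<in> set xs" "\<And>y. y \<in> set xs \<Longrightarrow> y \<le> x"
  shows "last xs = x"
proof -
  have xs: "xs = butlast xs @ [last xs]"
    using assms(2) by (cases xs) auto
  then have "\<forall>y\<in>set (butlast xs). y < last xs"
    using assms(1) by (metis list.set_intros(1) sorted_wrt_append)
  moreover have "x \<in> set (butlast xs) \<or> x = last xs"
    using assms(2) xs by (metis Un_iff empty_iff insert_iff list.set set_append)
  moreover have "last xs \<le> x"
    using assms by (cases xs) auto
  ultimately show ?thesis by fastforce
qed

lemma (in prob_space) indep_algebra_var_finite_increment: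
  assumes incr: "independent_increments X" and st: "0 \<le> s" "s < t" and J: "finite J" "J \<subseteq> {0..s}"
  shows "indep_algebra_var (vimage_algebra (space M) (\<lambda>\<omega>. \<lambda>j\<in>J. X j \<omega> - X 0 \<omega>) (Pi\<^sub>M J (\<lambda>_. borel)))
           borel (\<lambda>\<omega>. X t \<omega> - X s \<omega>)"
proof -
  define ts where "ts = sorted_list_of_set (J \<union> {0, s})"
  have set_ts: "set ts = J \<union> {0, s}"
    using J unfolding ts_def by (intro set_sorted_list_of_set) simp
  have sorted: "sorted_wrt (<) ts"
    by (simp add: ts_def)
  have bounds: "0 \<le> r \<and> r \<le> s" if "r \<in> set ts" for r
    using that set_ts J st by auto
  have last: "last ts = s"
    using sorted set_ts bounds by (intro last_eq_if_sorted_wrt_less) auto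
  have "Min (J \<union> {0, s}) = 0"
    using J st by (intro Min_eqI) auto
  then have first: "ts ! 0 = 0"
    using J sorted_list_of_set_nonempty[of "J \<union> {0, s}"] by (simp add: ts_def)
  have "\<forall>j\<in>J. \<exists>i<length ts. ts ! i = j"
    using set_ts by (metis UnI1 in_set_conv_nth)
  then obtain idx where idx: "\<And>j. j \<in> J \<Longrightarrow> idx j < length ts \<and> ts ! idx j = j"
    by metis
  have select: "(\<lambda>f. \<lambda>j\<in>J. f (idx j))
      \<in> Pi\<^sub>M {..<length ts} (\<lambda>_. borel) \<rightarrow>\<^sub>M Pi\<^sub>M J (\<lambda>_. borel :: real measure)"
    using idx by (intro measurable_restrict measurable_component_singleton) auto
  have "(\<lambda>j\<in>J. (\<lambda>i\<in>{..<length ts}. X (ts ! i) \<omega> - X 0 \<omega>) (idx j)) = (\<lambda>j\<in>J. X j \<omega> - X 0 \<omega>)" for \<omega>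
    using idx by (intro restrict_ext) simp
  moreover have "sorted_wrt (<) (ts @ [t])" "\<forall>r\<in>set (ts @ [t]). 0 \<le> r" "ts \<noteq> []"
    using sorted bounds st set_ts by (fastforce simp: sorted_wrt_append)+
  from indep_algebra_var_sorted_increments[OF incr this select]
  have "indep_algebra_var (vimage_algebra (space M)
      (\<lambda>\<omega>. \<lambda>j\<in>J. (\<lambda>i\<in>{..<length ts}. X (ts ! i) \<omega> - X 0 \<omega>) (idx j)) (Pi\<^sub>M J (\<lambda>_. borel)))
      borel (\<lambda>\<omega>. X t \<omega> - X s \<omega>)"
    by (simp only: first last)
  ultimately show ?thesis
    by (simp only:)
qed

lemma Int_stable_Union_finite_sigma_sets:
  assumes E: "\<And>i. i \<in> I \<Longrightarrow> E i \<subseteq> Pow \<Omega>"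
  shows "Int_stable (\<Union>J\<in>{J. finite J \<and> J \<subseteq> I}. sigma_sets \<Omega> (\<Union>j\<in>J. E j))" (is "Int_stable ?G")
proof (rule Int_stableI)
  let ?\<sigma> = "\<lambda>J. sigma_sets \<Omega> (\<Union>j\<in>J. E j)"
  fix a b assume "a \<in> ?G" "b \<in> ?G"
  then obtain J K where J: "finite J" "J \<subseteq> I" "a \<in> ?\<sigma> J" and K: "finite K" "K \<subseteq> I" "b \<in> ?\<sigma> K"
    by auto
  have mono: "?\<sigma> J' \<subseteq> ?\<sigma> (J \<union> K)" if "J' \<subseteq> J \<union> K" for J'
    using that by (intro sigma_sets_mono') auto
  have ab: "a \<in> ?\<sigma> (J \<union> K)" "b \<in> ?\<sigma> (J \<union> K)"
    using J(3) K(3) mono[of J] mono[of K] by auto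
  have "(\<Union>j\<in>J \<union> K. E j) \<subseteq> Pow \<Omega>"
    using E J K by blast
  then interpret sigma_algebra \<Omega> "?\<sigma> (J \<union> K)"
    by (rule sigma_algebra_sigma_sets)
  show "a \<inter> b \<in> ?G"
    using J K Int[OF ab] by blast
qed

lemma (in prob_space) indep_set_sigma_sets_UnionI:
  assumes indep: "\<And>J. finite J \<Longrightarrow> J \<subseteq> I \<Longrightarrow> indep_set (sigma_sets (space M) (\<Union>j\<in>J. E j)) B"
    and B: "Int_stable B"
  shows "indep_set (sigma_sets (space M) (\<Union>i\<in>I. E i)) (sigma_sets (space M) B)"
proof -
  let ?G = "\<Union>J\<in>{J. finite J \<and> J \<subseteq> I}. sigma_sets (space M) (\<Union>j\<in>J. E j)"
  have E: "E i \<subseteq> ?G" if "i \<in> I" for i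
    using that by (auto intro!: exI[of _ "{i}"])
  have G: "?G \<subseteq> events"
    using indep by (intro UN_least) (simp add: indep_sets2_eq)
  have "indep_set ?G B"
  proof (rule indep_setI[OF G])
    show "B \<subseteq> events"
      using indep[of "{}"] by (simp add: indep_sets2_eq)
    show "prob (a \<inter> b) = prob a * prob b" if "a \<in> ?G" "b \<in> B" for a b
      using that indep indep_setD by blast
  qed
  moreover have "E i \<subseteq> Pow (space M)" if "i \<in> I" for i
    using order.trans[OF E[OF that] G] sets.space_closed by (rule order.trans)
  then have "Int_stable ?G"
    by (rule Int_stable_Union_finite_sigma_sets)
  ultimately have "indep_set (sigma_sets (space M) ?G) (sigma_sets (space M) B)"
    using B by (rule indep_set_sigma_sets)
  moreover have "sigma_sets (space M) (\<Union>i\<in>I. E i) \<subseteq> sigma_sets (space M) ?G"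
    using E by (intro sigma_sets_mono' UN_least)
  ultimately show ?thesis
    by (rule indep_set_mono) simp
qed

lemma space_natural_filtration [simp]: "space (natural_filtration M X t) = space M"
  unfolding natural_filtration_def by (subst space_measure_of) auto

lemma sets_natural_filtration:
  "sets (natural_filtration M X t)
     = sigma_sets (space M) (\<Union>s\<in>{0..t}. {X s -` A \<inter> space M | A. A \<in> sets borel})"
  unfolding natural_filtration_def by (subst sets_measure_of) auto

lemma measurable_natural_filtration:
  assumes "0 \<le> s" "s \<le> t"
  shows "X s \<in> borel_measurable (natural_filtration M X t)"
proof (rule measurableI)
  fix A :: "real set" assume "A \<in> sets borel"
  then show "X s -` A \<inter> space (natural_filtration M X t) \<in> sets (natural_filtration M X t)"
    unfolding sets_natural_filtration using assms
    by (intro sigma_sets.Basic UN_I[of s] CollectI exI[of _ A]) auto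
qed simp

lemma subalgebra_natural_filtration:
  assumes "\<And>s. 0 \<le> s \<Longrightarrow> s \<le> t \<Longrightarrow> X s \<in> borel_measurable M"
  shows "subalgebra M (natural_filtration M X t)"
  unfolding subalgebra_def sets_natural_filtration
  using assms by (auto intro!: sets.sigma_sets_subset measurable_sets)

lemma (in prob_space) indep_natural_filtration_increment:
  assumes meas: "\<And>t. t \<ge> 0 \<Longrightarrow> random_variable borel (X t)"
    and X_0: "AE \<omega> in M. X 0 \<omega> = 0"
    and incr: "independent_increments X" and st: "0 \<le> s" "s < t"
  shows "indep_algebra_var (natural_filtration M X s) borel (\<lambda>\<omega>. X t \<omega> - X s \<omega>)"
proof -
  let ?D = "vimage_algebra (space M) (\<lambda>\<omega>. X t \<omega> - X s \<omega>) borel"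
  let ?E = "\<lambda>r. {X r -` A \<inter> space M | A. A \<in> sets borel}"
  have "indep_set (sigma_sets (space M) (\<Union>r\<in>{0..s}. ?E r)) (sigma_sets (space M) (sets ?D))"
  proof (rule indep_set_sigma_sets_UnionI)
    fix J assume J: "finite J" "J \<subseteq> {0..s}"
    let ?V = "\<lambda>\<omega>. \<lambda>j\<in>J. X j \<omega>" and ?P = "Pi\<^sub>M J (\<lambda>_. borel :: real measure)"
    have V: "random_variable ?P ?V" and increments: "random_variable ?P (\<lambda>\<omega>. \<lambda>j\<in>J. X j \<omega> - X 0 \<omega>)"
      using J meas by (auto intro!: measurable_restrict borel_measurable_diff)
    have "AE \<omega> in M. (\<lambda>j\<in>J. X j \<omega> - X 0 \<omega>) = ?V \<omega>"
      using X_0 by eventually_elim auto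
    from indep_algebra_var_vimage_cong_AE
      [OF indep_algebra_var_finite_increment[OF incr st J] this increments V]
    have "indep_set (sets (vimage_algebra (space M) ?V ?P)) (sets ?D)"
      by (simp add: indep_algebra_var_def)
    moreover have "?E j \<subseteq> sets (vimage_algebra (space M) ?V ?P)" if "j \<in> J" for j
    proof -
      have "?V \<in> vimage_algebra (space M) ?V ?P \<rightarrow>\<^sub>M ?P"
        by (rule measurable_vimage_algebra1) (auto simp: space_PiM)
      from measurable_compose[OF this measurable_component_singleton[OF that]]
      have "X j \<in> borel_measurable (vimage_algebra (space M) ?V ?P)"
        using that by simp
      from measurable_sets[OF this] show ?thesis by auto
    qed
    then have "sigma_sets (space M) (\<Union>j\<in>J. ?E j) \<subseteq> sets (vimage_algebra (space M) ?V ?P)"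
      using sets.sigma_sets_subset[of "\<Union>j\<in>J. ?E j" "vimage_algebra (space M) ?V ?P"] by auto
    ultimately show "indep_set (sigma_sets (space M) (\<Union>j\<in>J. ?E j)) (sets ?D)"
      by (rule indep_set_mono) simp
  qed (rule sets.Int_stable)
  then show ?thesis
    using sets.sigma_sets_eq[of ?D] by (simp add: indep_algebra_var_def sets_natural_filtration)
qed

lemma (in prob_space) indep_var_subalgebra:
  assumes F: "subalgebra M F" and indep: "indep_algebra_var F T Y"
    and X: "X \<in> F \<rightarrow>\<^sub>M S" and Y: "random_variable T Y"
  shows "indep_var S X T Y"
proof -
  have "{X -` A \<inter> space M | A. A \<in> sets S} \<subseteq> sets F"
    using measurable_sets[OF X] F by (auto simp: subalgebra_def)
  then have "sigma_sets (space M) {X -` A \<inter> space M | A. A \<in> sets S} \<subseteq> sets F"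
    using sets.sigma_sets_subset[of _ F] F by (simp add: subalgebra_def)
  then show ?thesis
    using indep measurable_from_subalg[OF F X] Y
    by (auto simp: indep_algebra_var_def indep_var_eq sets_vimage_algebra intro: indep_set_mono)
qed

section \<open>Appell martingales and Kendall polynomials\<close>

lemma moment_fps_restrict_space_nth:
  assumes "A \<in> sets M"
  shows "fps_nth (moment_fps (restrict_space M A) X) n = (LINT \<omega>|M. indicator A \<omega> * X \<omega> ^ n) / fact n"
  using assms by (simp add: integral_restrict_space)

lemma (in prob_space) moment_fps_add_indep:
  assumes F: "subalgebra M F" and indep: "indep_algebra_var F borel Y"
    and A: "A \<in> sets F" and X: "X \<in> borel_measurable F" and Y: "random_variable borel Y"
    and int: "\<And>k. integrable M (\<lambda>\<omega>. X \<omega> ^ k)" "\<And>k. integrable M (\<lambda>\<omega>. Y \<omega> ^ k)"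
  shows "moment_fps (restrict_space M A) (\<lambda>\<omega>. X \<omega> + Y \<omega>)
    = moment_fps (restrict_space M A) X * moment_fps M Y"
proof (rule fps_ext)
  fix n
  have A_ev: "A \<in> events"
    using A F by (auto simp: subalgebra_def)
  let ?Z = "\<lambda>i \<omega>. indicator A \<omega> * X \<omega> ^ i / fact i" and ?W = "\<lambda>i \<omega>. Y \<omega> ^ i / fact i"
  have int_Z: "integrable M (?Z i)" for i
    using integrable_real_mult_indicator[OF A_ev int(1)[of i]] by (simp add: mult.commute)
  have int_W: "integrable M (?W i)" for i
    by (intro integrable_divide int)
  have indep_ZW: "indep_var borel (?Z i) borel (?W j)" for i j
  proof -
    have "?Z i \<in> borel_measurable F"
      using A X by measurable
    from indep_var_compose
      [OF indep_var_subalgebra[OF F indep this Y], of "\<lambda>x. x" borel "\<lambda>y. y ^ j / fact j" borel]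
    show ?thesis by (simp add: comp_def)
  qed
  have "indicator A \<omega> * (X \<omega> + Y \<omega>) ^ n / fact n = (\<Sum>i=0..n. ?Z i \<omega> * ?W (n - i) \<omega>)" for \<omega>
  proof -
    have "(X \<omega> + Y \<omega>) ^ n / fact n = (\<Sum>i=0..n. X \<omega> ^ i / fact i * ?W (n - i) \<omega>)"
      using arg_cong[OF fps_exp_add_mult[of "X \<omega>" "Y \<omega>"], of "\<lambda>A. fps_nth A n"]
      by (simp add: fps_mult_nth)
    then show ?thesis
      by (simp only: times_divide_eq_right[symmetric] sum_distrib_left mult.assoc)
  qed
  then have "fps_nth (moment_fps (restrict_space M A) (\<lambda>\<omega>. X \<omega> + Y \<omega>)) n
      = expectation (\<lambda>\<omega>. \<Sum>i=0..n. ?Z i \<omega> * ?W (n - i) \<omega>)"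
    by (simp only: moment_fps_restrict_space_nth[OF A_ev] integral_divide_zero[symmetric])
  also have "\<dots> = (\<Sum>i=0..n. expectation (?Z i) * expectation (?W (n - i)))"
    using indep_var_integrable[OF indep_ZW int_Z int_W]
    by (simp only: Bochner_Integration.integral_sum indep_var_lebesgue_integral[OF indep_ZW int_Z int_W])
  also have "\<dots> = fps_nth (moment_fps (restrict_space M A) X * moment_fps M Y) n"
    unfolding fps_mult_nth moment_fps_restrict_space_nth[OF A_ev] by simp
  finally show "fps_nth (moment_fps (restrict_space M A) (\<lambda>\<omega>. X \<omega> + Y \<omega>)) n
      = fps_nth (moment_fps (restrict_space M A) X * moment_fps M Y) n" .
qed

lemma integrable_power_diff:
  fixes X Y :: "'a \<Rightarrow> real"
  assumes X: "integrable M (\<lambda>\<omega>. X \<omega> ^ n)" and Y: "integrable M (\<lambda>\<omega>. Y \<omega> ^ n)"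
    and [measurable]: "X \<in> borel_measurable M" "Y \<in> borel_measurable M"
  shows "integrable M (\<lambda>\<omega>. (X \<omega> - Y \<omega>) ^ n)"
proof (rule Bochner_Integration.integrable_bound)
  show "integrable M (\<lambda>\<omega>. 2 ^ n * (\<bar>X \<omega> ^ n\<bar> + \<bar>Y \<omega> ^ n\<bar>))"
    by (intro integrable_mult_right Bochner_Integration.integrable_add integrable_abs X Y)
  have "\<bar>x - y\<bar> ^ n \<le> 2 ^ n * (\<bar>x\<bar> ^ n + \<bar>y\<bar> ^ n)" for x y :: real
  proof -
    have "\<bar>x - y\<bar> ^ n \<le> (2 * max \<bar>x\<bar> \<bar>y\<bar>) ^ n"
      by (intro power_mono) auto
    also have "\<dots> = 2 ^ n * max \<bar>x\<bar> \<bar>y\<bar> ^ n"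
      by (rule power_mult_distrib)
    also have "\<dots> \<le> 2 ^ n * (\<bar>x\<bar> ^ n + \<bar>y\<bar> ^ n)"
      by (intro mult_left_mono) (auto simp: max_def)
    finally show ?thesis .
  qed
  then show "AE \<omega> in M. norm ((X \<omega> - Y \<omega>) ^ n) \<le> norm (2 ^ n * (\<bar>X \<omega> ^ n\<bar> + \<bar>Y \<omega> ^ n\<bar>))"
    by (intro AE_I2) (simp add: power_abs)
qed measurable

definition appell :: "real fps \<Rightarrow> nat \<Rightarrow> real \<Rightarrow> real" where
  "appell A n x = fact n * fps_nth (fps_exp x * inverse A) n"

lemma appell_altdef:
  "appell A n x = fact n * (\<Sum>i=0..n. x ^ i / fact i * fps_nth (inverse A) (n - i))"
  by (simp add: appell_def fps_mult_nth)

lemma borel_measurable_appell [measurable]: "appell A n \<in> borel_measurable borel"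
  unfolding appell_altdef[abs_def] by measurable

lemma integrable_appell:
  assumes "\<And>k. integrable M (\<lambda>\<omega>. X \<omega> ^ k)"
  shows "integrable M (\<lambda>\<omega>. appell A n (X \<omega>))"
  unfolding appell_altdef
  by (intro integrable_mult_right Bochner_Integration.integrable_sum integrable_mult_left
      integrable_divide assms)

lemma set_lebesgue_integral_appell:
  assumes A: "A \<in> sets M" and int: "\<And>k. integrable M (\<lambda>\<omega>. X \<omega> ^ k)"
  shows "(LINT \<omega>:A|M. appell B n (X \<omega>))
    = fact n * fps_nth (moment_fps (restrict_space M A) X * inverse B) n"
proof -
  have int_A: "integrable M (\<lambda>\<omega>. indicator A \<omega> * X \<omega> ^ k)" for k
    using integrable_real_mult_indicator[OF A int[of k]] by (simp add: mult.commute)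
  have "indicator A \<omega> * appell B n (X \<omega>)
      = fact n * (\<Sum>i=0..n. indicator A \<omega> * X \<omega> ^ i / fact i * fps_nth (inverse B) (n - i))" for \<omega>
    by (simp only: appell_altdef mult.left_commute[of "indicator A \<omega>"] sum_distrib_left
        times_divide_eq_right[symmetric] mult.assoc)
  then have "(LINT \<omega>:A|M. appell B n (X \<omega>))
      = fact n * (\<Sum>i=0..n. LINT \<omega>|M. indicator A \<omega> * X \<omega> ^ i / fact i * fps_nth (inverse B) (n - i))"
    unfolding set_lebesgue_integral_def real_scaleR_def
    by (simp only: integral_mult_right_zero)
       (subst Bochner_Integration.integral_sum; intro integrable_mult_left integrable_divide int_A refl)
  also have "\<dots> = fact n * fps_nth (moment_fps (restrict_space M A) X * inverse B) n"
    by (simp only: fps_mult_nth moment_fps_restrict_space_nth[OF A] integral_mult_left_zero integral_divide_zero)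
  finally show ?thesis .
qed

lemma (in prob_space) set_lebesgue_integral_appell_indep_diff:
  assumes F: "subalgebra M F" and A: "A \<in> sets F" and X: "X \<in> borel_measurable F"
    and Y: "random_variable borel Y" and indep: "indep_algebra_var F borel (\<lambda>\<omega>. Y \<omega> - X \<omega>)"
    and int_X: "\<And>k. integrable M (\<lambda>\<omega>. X \<omega> ^ k)" and int_Y: "\<And>k. integrable M (\<lambda>\<omega>. Y \<omega> ^ k)"
  shows "(LINT \<omega>:A|M. appell (moment_fps M Y) n (Y \<omega>))
    = (LINT \<omega>:A|M. appell (moment_fps M X) n (X \<omega>))"
proof -
  have X_rv: "random_variable borel X"
    using F X by (rule measurable_from_subalg)
  let ?d = "moment_fps M (\<lambda>\<omega>. Y \<omega> - X \<omega>)" and ?m = "\<lambda>B Z. moment_fps (restrict_space M B) Z"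
  have factor: "?m B Y = ?m B X * ?d" if "B \<in> sets F" for B
    using moment_fps_add_indep[OF F indep that X borel_measurable_diff[OF Y X_rv] int_X
        integrable_power_diff[OF int_Y int_X Y X_rv]] by simp
  have restrict_space: "?m (space M) Z = moment_fps M Z" for Z :: "'a \<Rightarrow> real"
    by (simp add: fps_eq_iff integral_restrict_space indicator_def
        cong: Bochner_Integration.integral_cong)
  have "space M \<in> sets F"
    using sets.top[of F] F by (simp only: subalgebra_def)
  from factor[OF this] have "moment_fps M Y = moment_fps M X * ?d"
    by (simp only: restrict_space)
  moreover have "fps_nth ?d 0 \<noteq> 0"
    by (simp add: prob_space)
  ultimately have "?m A Y * inverse (moment_fps M Y) = ?m A X * inverse (moment_fps M X)"
    by (simp add: factor[OF A] fps_inverse_mult inverse_mult_eq_1' mult_ac)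
  moreover have "A \<in> events"
    using A F by (auto simp: subalgebra_def)
  ultimately show ?thesis
    by (simp add: set_lebesgue_integral_appell int_X int_Y)
qed

lemma (in prob_space) martingale_appell:
  assumes F: "\<And>t. 0 \<le> t \<Longrightarrow> subalgebra M (F t)"
    and adapted: "\<And>t. 0 \<le> t \<Longrightarrow> X t \<in> borel_measurable (F t)"
    and indep: "\<And>s t. 0 \<le> s \<Longrightarrow> s < t \<Longrightarrow> indep_algebra_var (F s) borel (\<lambda>\<omega>. X t \<omega> - X s \<omega>)"
    and int: "\<And>t k. 0 \<le> t \<Longrightarrow> integrable M (\<lambda>\<omega>. X t \<omega> ^ k)"
  shows "martingale_wrt M F (\<lambda>t \<omega>. appell (moment_fps M (X t)) n (X t \<omega>))"
  unfolding martingale_wrt_def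
proof (intro conjI allI impI)
  fix t :: real assume t: "0 \<le> t"
  show "integrable M (\<lambda>\<omega>. appell (moment_fps M (X t)) n (X t \<omega>))"
    by (rule integrable_appell[OF int[OF t]])
  show "(\<lambda>\<omega>. appell (moment_fps M (X t)) n (X t \<omega>)) \<in> borel_measurable (F t)"
    using adapted[OF t] by measurable
next
  fix s t :: real and A assume s: "0 \<le> s" and "s \<le> t" and A: "A \<in> sets (F s)"
  show "(LINT \<omega>:A|M. appell (moment_fps M (X t)) n (X t \<omega>))
      = (LINT \<omega>:A|M. appell (moment_fps M (X s)) n (X s \<omega>))"
  proof (cases "s = t")
    case False
    with s \<open>s \<le> t\<close> have st: "s < t" and t: "0 \<le> t" by auto
    have "random_variable borel (X t)"
      using F[OF t] adapted[OF t] by (rule measurable_from_subalg)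
    then show ?thesis
      by (rule set_lebesgue_integral_appell_indep_diff
          [OF F[OF s] A adapted[OF s] _ indep[OF s st] int[OF s] int[OF t]])
  qed simp
qed

lemma fps_linear_ode_unique:
  fixes y z c :: "'a::field_char_0 fps"
  assumes y: "fps_deriv y = c * y" and z: "fps_deriv z = c * z" and init: "fps_nth y 0 = fps_nth z 0"
  shows "y = z"
proof (rule fps_ext)
  fix n
  show "fps_nth y n = fps_nth z n"
  proof (induction n rule: less_induct)
    case (less n)
    show ?case
    proof (cases n)
      case (Suc m)
      have "fps_nth (c * y) m = fps_nth (c * z) m"
        unfolding fps_mult_nth using less Suc by (intro sum.cong) auto
      then have "fps_nth (fps_deriv y) m = fps_nth (fps_deriv z) m"
        by (simp only: y z)
      then show ?thesis using Suc by (simp del: of_nat_Suc)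
    qed (use init in simp)
  qed
qed

lemma fps_exp_compose_add:
  fixes A B :: "'a::field_char_0 fps"
  assumes A: "fps_nth A 0 = 0" and B: "fps_nth B 0 = 0"
  shows "fps_exp 1 oo (A + B) = (fps_exp 1 oo A) * (fps_exp 1 oo B)"
proof (rule fps_linear_ode_unique[where c = "fps_deriv (A + B)"])
  show "fps_deriv (fps_exp 1 oo (A + B)) = fps_deriv (A + B) * (fps_exp 1 oo (A + B))"
    using A B by (simp add: fps_compose_deriv mult_ac)
  show "fps_deriv ((fps_exp 1 oo A) * (fps_exp 1 oo B))
      = fps_deriv (A + B) * ((fps_exp 1 oo A) * (fps_exp 1 oo B))"
    using A B by (simp add: fps_compose_deriv algebra_simps)
qed simp

lemma kendall_eq_appell:
  "kendall n (\<lambda>k. if k = 1 then x else - \<kappa> k) = appell (fps_exp 1 oo cumulant_fps \<kappa>) n x"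
proof -
  let ?K = "cumulant_fps \<kappa>"
  have K_0: "fps_nth ?K 0 = 0"
    by (simp add: cumulant_fps_def)
  have "(fps_exp 1 oo ?K) * (fps_exp 1 oo - ?K) = 1"
    using fps_exp_compose_add[of ?K "- ?K"] K_0 by simp
  then have inverse: "fps_exp 1 oo - ?K = inverse (fps_exp 1 oo ?K)"
    by (rule fps_inverse_unique[symmetric])
  have "Abs_fps (\<lambda>k. if k = 0 then 0 else (if k = 1 then x else - \<kappa> k) / fact k)
      = fps_const x * fps_X + - ?K"
    by (auto simp: fps_eq_iff cumulant_fps_def less_2_cases_iff)
  then have "kendall n (\<lambda>k. if k = 1 then x else - \<kappa> k)
      = fact n * fps_nth ((fps_exp 1 oo (fps_const x * fps_X)) * (fps_exp 1 oo - ?K)) n"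
    using K_0 unfolding kendall_def by (subst fps_exp_compose_add[symmetric]) simp_all
  then show ?thesis
    by (simp add: inverse appell_def)
qed

lemma martingale_wrt_cong:
  assumes "\<And>t \<omega>. 0 \<le> t \<Longrightarrow> Y t \<omega> = Z t \<omega>"
  shows "martingale_wrt M F Y \<longleftrightarrow> martingale_wrt M F Z"
proof -
  have "Y t = Z t" if "0 \<le> t" for t
    using assms[OF that] by blast
  then show ?thesis
    unfolding martingale_wrt_def by (intro conj_cong all_cong1 imp_cong refl) simp_all
qed

lemma set_lebesgue_integral_power_minus_0:
  fixes \<nu> :: "real measure"
  assumes "k \<ge> 1"
  shows "(LINT x:(UNIV - {0})|\<nu>. x ^ k) = (LINT x|\<nu>. x ^ k)"
  unfolding set_lebesgue_integral_def
  using assms by (intro Bochner_Integration.integral_cong) (auto simp: indicator_def)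

theorem theorem1:
  fixes M :: "'a measure" and X :: "real \<Rightarrow> 'a \<Rightarrow> real"
    and \<sigma>2 :: "real \<Rightarrow> real" and \<nu> :: "real \<Rightarrow> real measure"
    and F :: "nat \<Rightarrow> real \<Rightarrow> real" and n :: nat
  assumes P: "prob_space M"
    and meas: "\<And>t. t \<ge> 0 \<Longrightarrow> X t \<in> borel_measurable M"
    and X0: "AE \<omega> in M. X 0 \<omega> = 0"
    and indep_incr: "\<And>ts. sorted_wrt (<) ts \<Longrightarrow> (\<forall>t\<in>set ts. t \<ge> 0) \<Longrightarrow>
          prob_space.indep_vars M (\<lambda>_. borel)
            (\<lambda>i \<omega>. X (ts ! Suc i) \<omega> - X (ts ! i) \<omega>) {..<length ts - 1}"
    and cont_prob: "\<And>t e. t \<ge> 0 \<Longrightarrow> e > 0 \<Longrightarrow>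
          ((\<lambda>s. measure M {\<omega>\<in>space M. \<bar>X s \<omega> - X t \<omega>\<bar> > e}) \<longlongrightarrow> 0) (at t within {0..})"
    and cadlag: "AE \<omega> in M. \<forall>t\<ge>0. continuous (at_right t) (\<lambda>s. X s \<omega>) \<and>
                   (t > 0 \<longrightarrow> (\<exists>l. ((\<lambda>s. X s \<omega>) \<longlongrightarrow> l) (at_left t)))"
    and mean0: "\<And>t. t \<ge> 0 \<Longrightarrow> integral\<^sup>L M (X t) = 0"
    and moments: "\<And>t k. t \<ge> 0 \<Longrightarrow> k \<ge> 1 \<Longrightarrow> integrable M (\<lambda>\<omega>. \<bar>X t \<omega>\<bar> ^ k)"
    and LK: "\<And>t. t \<ge> 0 \<Longrightarrow> levy_khintchine (distr M borel (X t)) (\<sigma>2 t) (\<nu> t)"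
    and F2: "\<And>t. F 2 t = \<sigma>2 t + (LINT x:(UNIV - {0})|\<nu> t. x ^ 2)"
    and Fk: "\<And>k t. k \<ge> 3 \<Longrightarrow> F k t = (LINT x:(UNIV - {0})|\<nu> t. x ^ k)"
    and n: "n \<ge> 1"
  shows "martingale_wrt M (natural_filtration M X)
           (\<lambda>t \<omega>. kendall n (\<lambda>k. if k = 1 then X t \<omega> else - F k t))"
proof -
  interpret prob_space M by (rule P)
  have int: "integrable M (\<lambda>\<omega>. X t \<omega> ^ k)" if "t \<ge> 0" for t k
    using moments[OF that, of k] integrable_abs_iff[of "\<lambda>\<omega>. X t \<omega> ^ k" M] meas[OF that]
    by (cases "k = 0") (simp_all add: power_abs)
  have F_cumulant: "F k t = levy_cumulant (\<sigma>2 t) (\<nu> t) k" if "k \<ge> 2" for k t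
    using that F2[of t] Fk[of k t]
    by (cases "k = 2") (simp_all add: levy_cumulant_def set_lebesgue_integral_power_minus_0)
  then have "cumulant_fps (\<lambda>k. F k t) = cumulant_fps (levy_cumulant (\<sigma>2 t) (\<nu> t))" for t
    by (simp add: cumulant_fps_def fps_eq_iff)
  then have kendall: "kendall n (\<lambda>k. if k = 1 then X t \<omega> else - F k t)
      = appell (moment_fps M (X t)) n (X t \<omega>)" if "0 \<le> t" for t \<omega>
    unfolding kendall_eq_appell[where \<kappa> = "\<lambda>k. F k t"]
    using moment_fps_centred_levy_khintchine[OF meas int mean0 LK] that by simp
  have "independent_increments X"
    using indep_incr by (simp add: independent_increments_def)
  then have "martingale_wrt M (natural_filtration M X) (\<lambda>t \<omega>. appell (moment_fps M (X t)) n (X t \<omega>))"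
    by (intro martingale_appell subalgebra_natural_filtration measurable_natural_filtration
        indep_natural_filtration_increment meas X0 int) auto
  then show ?thesis
    by (rule martingale_wrt_cong[THEN iffD2, rotated]) (rule kendall)
qed

end
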